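(* Let $B$ be a set of cells of an $m\times n$ array that contains exactly $h\geq 3$ cells in each row and exactly $k\geq 3$ cells in each column, and assume that $B$ admits two compatible orderings $\alpha_r$ and $\alpha_c$. Given $\Omega\subset\mathbb{Z}_{2nk+t}$ such that $[\pm x\mid x\in\Omega]$ contains each element of $\mathbb{Z}_{2nk+t}\setminus\frac{2nk+t}{t}\mathbb{Z}_{2nk+t}$ exactly once, let $\mathcal{D}$ be the set of all the $\mathrm{NH}_t(m,n;h,k)$, $D$, such that $\mathrm{skel}(D)=B$ and $\mathcal{E}(D)=\Omega$. Choose $D\in\mathcal{D}$ uniformly at random, denote by $\omega_r$ and $\omega_c$ the compatible orderings of $D$ that correspond to $\alpha_r$ and $\alpha_c$, and by $\Pi$ the Archdeacon embedding of $K_{\frac{2nk+t}{t}\times t}$ defined by $D$ (with these orderings). Then the probability that there exists $\sigma\in \mathrm{Aut}(\Pi)$ that is not a translation (i.e. that $\mathrm{Aut}(\Pi)\neq\mathbb{Z}_{2nk+t}$) is, considering $t$ fixed, $O\left(\frac{1}{nk}\right)$.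
   Context: Asymptotic convention: "$O(\cdot)$, considering $t$ fixed" means that the implied constant depends only on $t$ (not on $m,n,h,k,B,\alpha_r,\alpha_c,\Omega$). Arrays. A partially filled (p.f.) array is a matrix in which some cells may be empty. Let $v=2nk+t$ where $t$ divides $2nk$, and let $J=\frac{v}{t}\mathbb{Z}_v$ be the subgroup of $\mathbb{Z}_v$ of order $t$. A quasi-Heffter array $\mathrm{QH}_t(m,n;h,k)$ is an $m\times n$ p.f. array $A$ with entries in $\mathbb{Z}_v$ such that each row contains exactly $h$ filled cells, each column contains exactly $k$ filled cells, and the multiset $[\pm x\mid x\in A]$ contains each element of $\mathbb{Z}_v\setminus J$ exactly once. A non-zero sum Heffter array $\mathrm{NH}_t(m,n;h,k)$ is a $\mathrm{QH}_t(m,n;h,k)$ in which, moreover, the sum of the elements of every row and of every column is different from $0$ in $\mathbb{Z}_v$. $\mathcal{E}(A)$ is the list (set) of entries of $A$; $\mathrm{skel}(A)$ is the set of filled cells of $A$. Orderings. An ordering $\alpha_r$ of the rows of $B$ is a permutation of $B$ that is the product of one cyclic permutation for each row, acting on all cells of $B$ in that row; an ordering $\alpha_c$ of the columns is defined similarly. They are compatible if $\alpha_r\circ\alpha_c$ (equivalently $\alpha_c\circ\alpha_r$) is a single cycle of length $|B|$. If $\mathrm{skel}(A)=B$ and $p(x)\in B$ is the cell of $A$ containing $x\in\mathcal{E}(A)$, the corresponding orderings of $A$ are the permutations of $\mathcal{E}(A)$ given by $\omega_r=p^{-1}\circ\alpha_r\circ p$ and $\omega_c=p^{-1}\circ\alpha_c\circ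 p$. Embeddings. A combinatorial embedding (into an orientable surface) of a connected graph $\Gamma$ is a pair $(\Gamma,\rho)$ where $\rho$ is a permutation of the oriented edges with $\rho(x,y)=(x,\rho_x(y))$, each $\rho_x$ being a cyclic permutation of all neighbours of $x$. $K_{\frac{v}{t}\times t}$ is the complete multipartite graph with $v/t$ parts of size $t$; its vertex set is identified with $\mathbb{Z}_v$, two vertices being adjacent iff their difference is not in $J$. The Archdeacon embedding defined by $A,\omega_r,\omega_c$ is $\Pi=(K_{\frac{v}{t}\times t},\rho)$ with $\rho(x,x+a)=(x,x+\rho_0(a))$, where $\rho_0$ is the permutation of $\pm\mathcal{E}(A)=\mathbb{Z}_v\setminus J$ given by $\rho_0(a)=-\omega_r(a)$ if $a\in\mathcal{E}(A)$ and $\rho_0(a)=\omega_c(-a)$ if $a\in-\mathcal{E}(A)$. Automorphisms. $\mathrm{Aut}(\Pi)$ is the group of graph automorphisms $\sigma$ (acting on oriented edges by $\sigma(x,y)=(\sigma(x),\sigma(y))$) such that either $\sigma\circ\rho=\rho\circ\sigma$ or $\sigma\circ\rho=\rho^{-1}\circ\sigma$. All translations $\tau_g(x)=x+g$, $g\in\mathbb{Z}_v$, belong to $\mathrm{Aut}(\Pi)$, and $\mathrm{Aut}(\Pi)=\mathbb{Z}_v$ means that it consists exactly of the translations. *)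

theory Defs
  imports
    "HOL-Probability.Probability"
    "HOL-Combinatorics.Orbits"
    "Graph_Theory.Pair_Digraph"
begin

section \<open>The cyclic group \<open>\<int>\<^sub>v\<close>\<close>

text \<open>
  \<open>\<int>\<^sub>v\<close> is represented by the canonical residues \<open>0, \<dots>, v - 1\<close>, since \<open>v\<close> is quantified
  inside the main statement and so cannot be the cardinality of a type.
\<close>

definition Zmod :: "nat \<Rightarrow> int set" where
  "Zmod v = {0..<int v}"

definition neg_mod :: "nat \<Rightarrow> int \<Rightarrow> int" where
  "neg_mod v x = (- x) mod int v"

text \<open>The subgroup \<open>J = (v/t) \<int>\<^sub>v\<close>; it has order \<open>t\<close> when \<open>t\<close> divides \<open>v\<close>.\<close>

definition Jsub :: "nat \<Rightarrow> nat \<Rightarrow> int set" where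
  "Jsub v t = (\<lambda>x. (int (v div t) * x) mod int v) ` Zmod v"

text \<open>The multiset \<open>[\<plusminus> x | x \<in> M]\<close>.\<close>

definition pm_mset :: "nat \<Rightarrow> int multiset \<Rightarrow> int multiset" where
  "pm_mset v M = M + image_mset (neg_mod v) M"

definition covers_once :: "nat \<Rightarrow> nat \<Rightarrow> int multiset \<Rightarrow> bool" where
  "covers_once v t M \<longleftrightarrow> (\<forall>x \<in> Zmod v - Jsub v t. count (pm_mset v M) x = 1)"


section \<open>Partially filled arrays\<close>

type_synonym cell = "nat \<times> nat"

definition row_cells :: "cell set \<Rightarrow> nat \<Rightarrow> cell set" where
  "row_cells B i = {c \<in> B. fst c = i}"

definition col_cells :: "cell set \<Rightarrow> nat \<Rightarrow> cell set" where
  "col_cells B j = {c \<in> B. snd c = j}"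

definition cells_shape :: "nat \<Rightarrow> nat \<Rightarrow> nat \<Rightarrow> nat \<Rightarrow> cell set \<Rightarrow> bool" where
  "cells_shape m n h k B \<longleftrightarrow>
     B \<subseteq> {..<m} \<times> {..<n} \<and>
     (\<forall>i<m. card (row_cells B i) = h) \<and>
     (\<forall>j<n. card (col_cells B j) = k)"

text \<open>A partially filled array is a partial map; empty cells are mapped to \<open>None\<close>.\<close>

type_synonym pf_array = "cell \<rightharpoonup> int"

abbreviation skel :: "pf_array \<Rightarrow> cell set" where
  "skel A \<equiv> dom A"

abbreviation entries :: "pf_array \<Rightarrow> int set" where
  "entries A \<equiv> ran A"

definition entries_mset :: "pf_array \<Rightarrow> int multiset" where
  "entries_mset A = image_mset (\<lambda>c. the (A c)) (mset_set (skel A))"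

definition quasi_heffter :: "nat \<Rightarrow> nat \<Rightarrow> nat \<Rightarrow> nat \<Rightarrow> nat \<Rightarrow> pf_array \<Rightarrow> bool" where
  "quasi_heffter t m n h k A \<longleftrightarrow>
     (let v = 2 * n * k + t in
        t > 0 \<and> t dvd 2 * n * k \<and>
        cells_shape m n h k (skel A) \<and>
        entries A \<subseteq> Zmod v \<and>
        covers_once v t (entries_mset A))"

definition nonzero_heffter :: "nat \<Rightarrow> nat \<Rightarrow> nat \<Rightarrow> nat \<Rightarrow> nat \<Rightarrow> pf_array \<Rightarrow> bool" where
  "nonzero_heffter t m n h k A \<longleftrightarrow>
     quasi_heffter t m n h k A \<and>
     (let v = 2 * n * k + t in
        (\<forall>i<m. (\<Sum>c\<in>row_cells (skel A) i. the (A c)) mod int v \<noteq> 0) \<and>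
        (\<forall>j<n. (\<Sum>c\<in>col_cells (skel A) j. the (A c)) mod int v \<noteq> 0))"


section \<open>Orderings\<close>

text \<open>
  A permutation of \<open>B\<close> that is a product of one full cycle on each row (column). As usual with
  \<^term>\<open>(permutes)\<close>, it is extended by the identity outside \<open>B\<close>.
\<close>

definition row_ordering :: "nat \<Rightarrow> cell set \<Rightarrow> (cell \<Rightarrow> cell) \<Rightarrow> bool" where
  "row_ordering m B \<alpha> \<longleftrightarrow> \<alpha> permutes B \<and> (\<forall>i<m. cyclic_on \<alpha> (row_cells B i))"

definition col_ordering :: "nat \<Rightarrow> cell set \<Rightarrow> (cell \<Rightarrow> cell) \<Rightarrow> bool" where
  "col_ordering n B \<alpha> \<longleftrightarrow> \<alpha> permutes B \<and> (\<forall>j<n. cyclic_on \<alpha> (col_cells B j))"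

definition compatible :: "cell set \<Rightarrow> (cell \<Rightarrow> cell) \<Rightarrow> (cell \<Rightarrow> cell) \<Rightarrow> bool" where
  "compatible B \<alpha>r \<alpha>c \<longleftrightarrow> cyclic_on (\<alpha>r \<circ> \<alpha>c) B"

text \<open>
  The cell containing \<open>x\<close>; meaningful for \<open>x \<in> entries A\<close> when no entry of \<open>A\<close> is repeated,
  which holds for every quasi-Heffter array.
\<close>

definition position :: "pf_array \<Rightarrow> int \<Rightarrow> cell" where
  "position A x = (THE c. A c = Some x)"

definition entry_ordering :: "pf_array \<Rightarrow> (cell \<Rightarrow> cell) \<Rightarrow> int \<Rightarrow> int" where
  "entry_ordering A \<alpha> x = (if x \<in> entries A then the (A (\<alpha> (position A x))) else x)"


section \<open>Embeddings and their automorphisms\<close>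

text \<open>
  An embedding is a graph, given as a symmetric digraph whose arcs are the oriented edges,
  together with a permutation of its arcs (the identity elsewhere).
\<close>

type_synonym 'a embedding = "'a pair_pre_digraph \<times> ('a \<times> 'a \<Rightarrow> 'a \<times> 'a)"

text \<open>The complete multipartite graph with \<open>v/t\<close> parts of size \<open>t\<close>, the cosets of \<open>J\<close>.\<close>

definition multipartite_graph :: "nat \<Rightarrow> nat \<Rightarrow> int pair_pre_digraph" where
  "multipartite_graph v t =
     \<lparr> pverts = Zmod v,
       parcs = {(x, y). x \<in> Zmod v \<and> y \<in> Zmod v \<and> (y - x) mod int v \<notin> Jsub v t} \<rparr>"

definition archdeacon_rho0 ::
    "nat \<Rightarrow> pf_array \<Rightarrow> (int \<Rightarrow> int) \<Rightarrow> (int \<Rightarrow> int) \<Rightarrow> int \<Rightarrow> int" where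
  "archdeacon_rho0 v A \<omega>r \<omega>c a =
     (if a \<in> entries A then neg_mod v (\<omega>r a)
      else if a \<in> neg_mod v ` entries A then \<omega>c (neg_mod v a)
      else a)"

definition archdeacon_embedding ::
    "nat \<Rightarrow> nat \<Rightarrow> pf_array \<Rightarrow> (int \<Rightarrow> int) \<Rightarrow> (int \<Rightarrow> int) \<Rightarrow> int embedding" where
  "archdeacon_embedding v t A \<omega>r \<omega>c =
     (multipartite_graph v t,
      \<lambda>(x, y). if (x, y) \<in> parcs (multipartite_graph v t)
                then (x, (x + archdeacon_rho0 v A \<omega>r \<omega>c ((y - x) mod int v)) mod int v)
                else (x, y))"

definition graph_automorphism :: "'a pair_pre_digraph \<Rightarrow> ('a \<Rightarrow> 'a) \<Rightarrow> bool" where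
  "graph_automorphism G \<sigma> \<longleftrightarrow>
     \<sigma> permutes pverts G \<and>
     (\<forall>x\<in>pverts G. \<forall>y\<in>pverts G. (\<sigma> x, \<sigma> y) \<in> parcs G \<longleftrightarrow> (x, y) \<in> parcs G)"

definition embedding_Aut :: "'a embedding \<Rightarrow> ('a \<Rightarrow> 'a) set" where
  "embedding_Aut E =
     (case E of (G, \<rho>) \<Rightarrow>
        {\<sigma>. graph_automorphism G \<sigma> \<and>
             ((\<forall>e\<in>parcs G. map_prod \<sigma> \<sigma> (\<rho> e) = \<rho> (map_prod \<sigma> \<sigma> e)) \<or>
              (\<forall>e\<in>parcs G. map_prod \<sigma> \<sigma> (\<rho> e) = inv \<rho> (map_prod \<sigma> \<sigma> e)))})"

text \<open>
  Automorphisms are functions on all of \<^typ>\<open>int\<close> that fix everything outside \<open>\<int>\<^sub>v\<close>; hence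
  so must the translations.
\<close>

definition translation :: "nat \<Rightarrow> int \<Rightarrow> int \<Rightarrow> int" where
  "translation v g x = (if x \<in> Zmod v then (x + g) mod int v else x)"

definition translation_set :: "nat \<Rightarrow> (int \<Rightarrow> int) set" where
  "translation_set v = translation v ` Zmod v"

end

theory Submission
  imports Defs "HOL-Number_Theory.Cong"
begin

text \<open>
  Subtracting a translation, an automorphism \<open>\<sigma>\<close> may be assumed to fix \<open>0\<close>; at every vertex \<open>x\<close> it
  then acts on the neighbours as an element of the dihedral group of the cycle \<open>\<rho>\<^sub>0\<close>. The element
  \<open>g\<close> at \<open>0\<close> is one of at most \<open>4nk\<close>, and it forces the element \<open>h\<^sub>i\<close> at \<open>x\<^sub>i\<close> through the edge
  from \<open>x\<^sub>i\<close> to \<open>0\<close>. Indexing the entries and their negatives by signed cells, so that \<open>g\<close> and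
  \<open>h\<^sub>i\<close> do not depend on the array, every relation \<open>x\<^sub>i + x\<^sub>j = x\<^sub>p\<close> thus implies
  \<open>x\<^bsub>g i\<^esub> + x\<^bsub>h\<^sub>i j\<^esub> = x\<^bsub>g p\<^esub>\<close>. For fixed \<open>i\<close> and \<open>j\<close> whose four cells are distinct this has probability
  \<open>O(1/nk)\<close>: there are \<open>2nk\<close> choices of \<open>p\<close>, and two equations have to hold unless \<open>p\<close> or \<open>g p\<close> lies
  in one of boundedly many cells, while \<open>x\<^sub>i + x\<^sub>j \<in> J\<close> has probability \<open>O(t/nk)\<close>. A second pair \<open>(i, j)\<close> with fresh cells yields \<open>O(1/(nk)\<^sup>2)\<close>
  for each \<open>g \<noteq> id\<close>, and \<open>O(1/nk)\<close> in total. As \<open>h, k \<ge> 3\<close>, at least one seventh of all bijections from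
  \<open>B\<close> to \<open>\<Omega>\<close> have no vanishing row or column sum, so that conditioning on this only costs a
  constant factor.
\<close>

section \<open>Bijections as partial maps\<close>

text \<open>Only domain and range are prescribed; injectivity follows by counting once
  \<open>B\<close> is finite and \<open>card B = card W\<close>.\<close>

definition bijs :: "'a set \<Rightarrow> 'b set \<Rightarrow> ('a \<rightharpoonup> 'b) set" where
  "bijs B W = {D. dom D = B \<and> ran D = W}"

lemma bijs_image:
  assumes "D \<in> bijs B W"
  shows "D ` B = Some ` W"
proof -
  have "D c \<in> Some ` ran D" if "c \<in> dom D" for c using that by (auto intro: ranI)
  moreover have "Some y \<in> D ` dom D" if "y \<in> ran D" for y
  proof -
    from that obtain a where a: "D a = Some y" by (auto simp: ran_def)
    then have "a \<in> dom D" by blast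
    then show ?thesis using a by (metis imageI)
  qed
  ultimately show ?thesis using assms unfolding bijs_def by blast
qed

lemma bijs_inj_on:
  assumes "finite B" "card B = card W" "D \<in> bijs B W"
  shows "inj_on D B"
proof -
  have "card (D ` B) = card B"
    unfolding bijs_image[OF assms(3)] using assms(2) by (simp add: card_image)
  then show ?thesis using assms(1) by (simp add: eq_card_imp_inj_on)
qed

lemma bijs_comp:
  assumes "p permutes B" "D \<in> bijs B W"
  shows "D \<circ> p \<in> bijs B W"
proof -
  have "dom (D \<circ> p) = B"
  proof (rule set_eqI)
    fix x
    have "x \<in> dom (D \<circ> p) \<longleftrightarrow> p x \<in> dom D" by auto
    also have "\<dots> \<longleftrightarrow> x \<in> B" using assms permutes_in_image[OF assms(1)] by (simp add: bijs_def)
    finally show "x \<in> dom (D \<circ> p) \<longleftrightarrow> x \<in> B" .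
  qed
  moreover have "ran (D \<circ> p) = ran D"
    unfolding ran_def using permutes_surj[OF assms(1)] by (auto simp: surj_def) metis
  ultimately show ?thesis using assms(2) by (simp add: bijs_def)
qed

text \<open>The permutation is \<open>D\<close> followed by the inverse of \<open>D'\<close> on
  \<open>B\<close>, and the identity elsewhere; it fixes \<open>Z\<close> because there
  \<open>D\<close> and \<open>D'\<close> agree and \<open>D'\<close> is injective on
  \<open>B\<close>.\<close>

lemma bijs_agree_permutes:
  assumes B: "finite B" "card B = card W" and D: "D \<in> bijs B W" "D' \<in> bijs B W"
    and agree: "\<forall>c\<in>Z. D c = D' c" and Z: "Z \<subseteq> B"
  obtains p where "p permutes (B - Z)" "D = D' \<circ> p"
proof -
  note inj = bijs_inj_on[OF B D(1)] and inj' = bijs_inj_on[OF B D(2)]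
  have im: "D ` B = D' ` B" using bijs_image D by metis
  define p where "p c = (if c \<in> B then inv_into B D' (D c) else c)" for c
  have pB: "p c \<in> B" "D' (p c) = D c" if "c \<in> B" for c
  proof -
    have "D c \<in> D' ` B" using that im by blast
    then show "p c \<in> B" "D' (p c) = D c"
      using that by (auto simp: p_def inv_into_into f_inv_into_f)
  qed
  have pZ: "p c = c" if "c \<notin> B - Z" for c
    using that agree Z inj' by (auto simp: p_def)
  have injp: "inj_on p B"
    by (rule inj_onI) (metis inj inj_onD pB(2))
  have "p permutes B"
    by (rule bij_imp_permutes)
       (use injp pB(1) B(1) pZ in \<open>auto simp: bij_betw_def endo_inj_surj image_subset_iff\<close>)
  then have "p permutes (B - Z)"
    by (rule permutes_superset) (use pZ in auto)
  moreover have "D = D' \<circ> p"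
  proof
    fix c show "D c = (D' \<circ> p) c"
    proof (cases "c \<in> B")
      case True then show ?thesis using pB by simp
    next
      case False
      then have "D c = None" "D' c = None" using D by (auto simp: bijs_def dom_def)
      then show ?thesis using False by (simp add: p_def)
    qed
  qed
  ultimately show thesis by (rule that)
qed

text \<open>All members arise from one fixed member by permuting \<open>B - Z\<close>. Only an upper
  bound is claimed, since \<open>\<phi>\<close> need not extend to a bijection.\<close>

lemma card_bijs_extending:
  assumes B: "finite B" "card B = card W" and Z: "Z \<subseteq> B"
  shows "finite {D \<in> bijs B W. \<forall>c\<in>Z. D c = \<phi> c}" (is "finite ?A")
    and "card {D \<in> bijs B W. \<forall>c\<in>Z. D c = \<phi> c} \<le> fact (card B - card Z)"
proof -
  have "finite ?A \<and> card ?A \<le> fact (card B - card Z)"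
  proof (cases "?A = {}")
    case True then show ?thesis by (simp only: True) simp
  next
    case False
    then obtain D0 where D0: "D0 \<in> ?A" by blast
    let ?P = "{p. p permutes (B - Z)}"
    have sub: "?A \<subseteq> (\<lambda>p. D0 \<circ> p) ` ?P"
    proof
      fix D assume "D \<in> ?A"
      with D0 have "D \<in> bijs B W" "D0 \<in> bijs B W" "\<forall>c\<in>Z. D c = D0 c" by auto
      from bijs_agree_permutes[OF B this Z] show "D \<in> (\<lambda>p. D0 \<circ> p) ` ?P" by blast
    qed
    have fin: "finite ?P" using B by (intro finite_permutations) auto
    have "card ?P = fact (card B - card Z)"
      using B Z by (intro card_permutations) (auto simp: card_Diff_subset finite_subset)
    moreover have "card ?A \<le> card ((\<lambda>p. D0 \<circ> p) ` ?P)"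
      by (rule card_mono[OF finite_imageI[OF fin] sub])
    moreover have "card ((\<lambda>p. D0 \<circ> p) ` ?P) \<le> card ?P" by (rule card_image_le[OF fin])
    ultimately show ?thesis using finite_subset[OF sub finite_imageI[OF fin]] by linarith
  qed
  then show "finite ?A" "card ?A \<le> fact (card B - card Z)" by auto
qed

lemma finite_bijs:
  assumes "finite B" "card B = card W"
  shows "finite (bijs B W)"
  using card_bijs_extending(1)[OF assms, of "{}"] by simp

text \<open>The permutations of \<open>B\<close> act freely on \<open>bijs B W\<close> by
  composition, so a single element already produces \<open>fact (card B)\<close> of them; the upper
  bound is the case \<open>Z = {}\<close> of \<open>card_bijs_extending\<close>.\<close>

lemma card_bijs:
  assumes B: "finite B" "card B = card W" and ne: "bijs B W \<noteq> {}"
  shows "card (bijs B W) = fact (card B)"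
proof (rule antisym)
  show "card (bijs B W) \<le> fact (card B)"
    using card_bijs_extending(2)[OF B, of "{}"] by simp
  obtain D0 where D0: "D0 \<in> bijs B W" using ne by blast
  let ?P = "{p. p permutes B}"
  have "inj_on (\<lambda>p. D0 \<circ> p) ?P"
  proof (rule inj_onI)
    fix p q assume pq: "p \<in> ?P" "q \<in> ?P" "D0 \<circ> p = D0 \<circ> q"
    show "p = q"
    proof
      fix c show "p c = q c"
      proof (cases "c \<in> B")
        case True
        then have "p c \<in> B" "q c \<in> B" using pq permutes_in_image by fastforce+
        then show ?thesis using bijs_inj_on[OF B D0] pq(3) by (metis comp_apply inj_onD)
      next
        case False then show ?thesis using pq permutes_not_in[of p B c] permutes_not_in[of q B c] by simp
      qed
    qed
  qed
  then have "card ((\<lambda>p. D0 \<circ> p) ` ?P) = fact (card B)"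
    using B by (simp add: card_image card_permutations)
  moreover have "(\<lambda>p. D0 \<circ> p) ` ?P \<subseteq> bijs B W" using bijs_comp D0 by blast
  ultimately show "fact (card B) \<le> card (bijs B W)"
    using finite_bijs[OF B] by (metis card_mono)
qed

section \<open>Counting bijections through determined values\<close>

lemma card_le_by_key:
  assumes K: "finite K" "f ` A \<subseteq> K" and A: "finite A" and c: "0 \<le> c"
    and fib: "\<And>x. x \<in> A \<Longrightarrow> real (card {y \<in> A. f y = f x}) \<le> c"
  shows "real (card A) \<le> real (card K) * c"
proof -
  have "card A = card (\<Union>z\<in>f ` A. {y \<in> A. f y = z})"
    by (rule arg_cong[of _ _ card]) auto
  also have "\<dots> \<le> (\<Sum>z\<in>f ` A. card {y \<in> A. f y = z})"
    using A by (intro card_UN_le) auto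
  finally have "card A \<le> (\<Sum>z\<in>f ` A. card {y \<in> A. f y = z})" .
  then have "real (card A) \<le> (\<Sum>z\<in>f ` A. real (card {y \<in> A. f y = z}))"
    by (metis of_nat_le_iff of_nat_sum)
  also have "\<dots> \<le> real (card (f ` A)) * c"
    using fib by (intro sum_bounded_above) auto
  also have "\<dots> \<le> real (card K) * c"
    using K c by (intro mult_right_mono) (auto intro: card_mono)
  finally show ?thesis .
qed

text \<open>The \<open>e\<close> largest factors of \<open>fact a\<close> all exceed
  \<open>a - e\<close>, hence are at least \<open>N / 2\<close>.\<close>

lemma fact_ge_half_power:
  assumes "e \<le> a" "N \<le> 2 * (a - e)"
  shows "fact (a - e) * (real N / 2) ^ e \<le> (fact a :: real)"
  using assms
proof (induction e)
  case (Suc e)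
  have eq: "a - e = Suc (a - Suc e)" using Suc.prems by simp
  have "fact (a - Suc e) * (real N / 2) ^ Suc e
      = (real N / 2) * fact (a - Suc e) * (real N / 2) ^ e" by simp
  also have "\<dots> \<le> real (a - e) * fact (a - Suc e) * (real N / 2) ^ e"
    using Suc.prems by (intro mult_right_mono) auto
  also have "real (a - e) * fact (a - Suc e) = fact (a - e)" unfolding eq by simp
  also have "fact (a - e) * (real N / 2) ^ e \<le> fact a"
    using Suc.prems by (intro Suc.IH) auto
  finally show ?case .
qed simp

text \<open>
  Given the values on \<open>T\<close>, the \<open>r\<close> remaining values on \<open>S - Z\<close> are determined; each of them
  gains a factor of order \<open>1 / N\<close>.
\<close>

lemma card_bijs_determined:
  fixes \<A> :: "('a \<rightharpoonup> 'b) set" and b :: real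
  assumes B: "finite B" "card B = card W"
    and \<A>: "\<A> \<subseteq> bijs B W" and S: "S \<subseteq> B" "T \<subseteq> S"
    and det: "\<And>D D'. D \<in> \<A> \<Longrightarrow> D' \<in> \<A> \<Longrightarrow> \<forall>c\<in>T. D c = D' c \<Longrightarrow> \<forall>c\<in>S. D c = D' c"
    and b: "0 \<le> b"
    and fib: "\<And>D. D \<in> \<A> \<Longrightarrow> real (card {D' \<in> \<A>. \<forall>c\<in>S. D' c = D c}) \<le> b * fact (card B - card S)"
    and card: "card S = z + e" "card T + r = e" and big: "2 * (z + e) \<le> card B" "0 < card B"
  shows "real (card \<A>) \<le> b * fact (card B - z) * 2 ^ e / real (card B) ^ r"
proof -
  let ?N = "card B" and ?f = "\<lambda>D. restrict (\<lambda>c. the (D c)) T"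
  let ?K = "PiE T (\<lambda>_. W)"
  have finW: "finite W" using B big by (simp add: card_ge_0_finite)
  have finT: "finite T" by (rule finite_subset[OF order_trans[OF S(2,1)] B(1)])
  have fin: "finite \<A>" by (rule finite_subset[OF \<A> finite_bijs[OF B]])
  have K: "finite ?K" "card ?K = ?N ^ card T"
    using finT finW B by (simp_all add: finite_PiE card_PiE)
  have dom: "\<exists>y\<in>W. D c = Some y" if "D \<in> \<A>" "c \<in> T" for D c
  proof -
    have "D c \<in> D ` B" using that S by blast
    then show ?thesis using bijs_image[of D B W] that \<A> by auto
  qed
  have sub: "?f ` \<A> \<subseteq> ?K"
  proof (rule image_subsetI)
    fix D assume "D \<in> \<A>"
    then have "the (D c) \<in> W" if "c \<in> T" for c using dom[of D c] that by force
    then show "?f D \<in> ?K" by auto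
  qed
  have agree: "\<forall>c\<in>T. D c = D' c" if "D \<in> \<A>" "D' \<in> \<A>" "?f D = ?f D'" for D D'
  proof
    fix c assume c: "c \<in> T"
    then have "the (D c) = the (D' c)" using that(3) by (metis restrict_apply')
    then show "D c = D' c" using dom[OF that(1) c] dom[OF that(2) c] by auto
  qed
  have "real (card {D' \<in> \<A>. ?f D' = ?f D}) \<le> b * fact (?N - card S)" if D: "D \<in> \<A>" for D
  proof -
    \<comment> \<open>Agreement on \<open>T\<close> spreads to \<open>S\<close> by
      \<open>det\<close>, so a fibre of the key lies in a set that \<open>fib\<close>
      bounds.\<close>
    have "{D' \<in> \<A>. ?f D' = ?f D} \<subseteq> {D' \<in> \<A>. \<forall>c\<in>S. D' c = D c}"
      using agree[OF _ D] det[OF _ D] by blast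
    then have "card {D' \<in> \<A>. ?f D' = ?f D} \<le> card {D' \<in> \<A>. \<forall>c\<in>S. D' c = D c}"
      using fin by (intro card_mono) auto
    then show ?thesis using fib[OF D] by linarith
  qed
  then have "real (card \<A>) \<le> real (card ?K) * (b * fact (?N - card S))"
    using b by (intro card_le_by_key[OF K(1) sub fin]) auto
  also have "\<dots> = b * real ?N ^ card T * fact (?N - z - e)"
    using K card by simp
  \<comment> \<open>As \<open>card T = e - r\<close>, the number of keys is
    \<open>card B ^ e / card B ^ r\<close>; its numerator is written as
    \<open>2 ^ e * (card B / 2) ^ e\<close> so that the factorial can absorb the power.\<close>
  also have "\<dots> = b * (fact (?N - z - e) * (real ?N / 2) ^ e) * 2 ^ e / real ?N ^ r"
    using big by (simp add: card(2)[symmetric] power_add field_simps)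
  also have "\<dots> \<le> b * fact (?N - z) * 2 ^ e / real ?N ^ r"
  proof -
    have "fact (?N - z - e) * (real ?N / 2) ^ e \<le> (fact (?N - z) :: real)"
      using big by (intro fact_ge_half_power) auto
    then show ?thesis using b by (intro divide_right_mono mult_right_mono mult_left_mono) auto
  qed
  finally show ?thesis .
qed

section \<open>The dihedral group acting on signed cells\<close>

lemma cyclic_on_no_short_cycle:
  assumes "cyclic_on f S" "card S \<ge> 3" "x \<in> S"
  shows "f x \<noteq> x" "f (f x) \<noteq> x"
proof -
  have S: "S = orbit f x" using assms by (simp add: cyclic_on_alldef)
  show 2: "f (f x) \<noteq> x"
  proof
    assume ff: "f (f x) = x"
    have "y \<in> {x, f x}" if "y \<in> orbit f x" for y
      using that by induction (auto simp: ff)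
    then have "card S \<le> card {x, f x}" unfolding S by (intro card_mono) auto
    also have "\<dots> \<le> 2" by (simp add: card_insert_if)
    finally show False using assms(2) by simp
  qed
  then show "f x \<noteq> x" by auto
qed

definition flip :: "'a \<times> bool \<Rightarrow> 'a \<times> bool" where
  "flip p = (fst p, \<not> snd p)"

lemma flip_simps [simp]:
  "fst (flip p) = fst p" "snd (flip p) = (\<not> snd p)" "flip (flip p) = p" "flip p \<noteq> p"
  by (auto simp: flip_def prod_eq_iff)

locale orderings =
  fixes m n h k :: nat and B :: "cell set" and \<alpha>r \<alpha>c :: "cell \<Rightarrow> cell"
  assumes h3: "h \<ge> 3" and k3: "k \<ge> 3"
    and shape: "cells_shape m n h k B"
    and row_ord: "row_ordering m B \<alpha>r" and col_ord: "col_ordering n B \<alpha>c"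
    and compat: "compatible B \<alpha>r \<alpha>c"
begin

lemma finite_B: "finite B"
  by (rule finite_subset[of _ "{..<m} \<times> {..<n}"]) (use shape in \<open>auto simp: cells_shape_def\<close>)

lemma row_perm: "\<alpha>r permutes B" and col_perm: "\<alpha>c permutes B"
  using row_ord col_ord by (simp_all add: row_ordering_def col_ordering_def)

lemma ord_in_iff [simp]: "\<alpha>r c \<in> B \<longleftrightarrow> c \<in> B" "\<alpha>c c \<in> B \<longleftrightarrow> c \<in> B"
  using permutes_in_image[OF row_perm] permutes_in_image[OF col_perm] by simp_all

lemma row_cell:
  assumes "c \<in> B"
  shows "fst c < m" "c \<in> row_cells B (fst c)" "cyclic_on \<alpha>r (row_cells B (fst c))"
    "card (row_cells B (fst c)) = h"
proof -
  show "fst c < m" using assms shape by (auto simp: cells_shape_def)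
  then show "cyclic_on \<alpha>r (row_cells B (fst c))" "card (row_cells B (fst c)) = h"
    using row_ord shape by (auto simp: row_ordering_def cells_shape_def)
  show "c \<in> row_cells B (fst c)" using assms by (simp add: row_cells_def)
qed

lemma col_cell:
  assumes "c \<in> B"
  shows "snd c < n" "c \<in> col_cells B (snd c)" "cyclic_on \<alpha>c (col_cells B (snd c))"
    "card (col_cells B (snd c)) = k"
proof -
  show "snd c < n" using assms shape by (auto simp: cells_shape_def)
  then show "cyclic_on \<alpha>c (col_cells B (snd c))" "card (col_cells B (snd c)) = k"
    using col_ord shape by (auto simp: col_ordering_def cells_shape_def)
  show "c \<in> col_cells B (snd c)" using assms by (simp add: col_cells_def)
qed

lemma fst_row: "c \<in> B \<Longrightarrow> fst (\<alpha>r c) = fst c"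
  using cyclic_on_inI[OF row_cell(3)[of c] row_cell(2)[of c]] by (simp add: row_cells_def)

lemma snd_col: "c \<in> B \<Longrightarrow> snd (\<alpha>c c) = snd c"
  using cyclic_on_inI[OF col_cell(3)[of c] col_cell(2)[of c]] by (simp add: col_cells_def)

lemma row_neq:
  assumes "c \<in> B"
  shows "\<alpha>r c \<noteq> c" "\<alpha>r (\<alpha>r c) \<noteq> c"
proof -
  have "card (row_cells B (fst c)) \<ge> 3" using row_cell(4)[OF assms] h3 by simp
  from cyclic_on_no_short_cycle[OF row_cell(3)[OF assms] this row_cell(2)[OF assms]]
  show "\<alpha>r c \<noteq> c" "\<alpha>r (\<alpha>r c) \<noteq> c" .
qed

lemma col_neq:
  assumes "c \<in> B"
  shows "\<alpha>c c \<noteq> c" "\<alpha>c (\<alpha>c c) \<noteq> c"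
proof -
  have "card (col_cells B (snd c)) \<ge> 3" using col_cell(4)[OF assms] k3 by simp
  from cyclic_on_no_short_cycle[OF col_cell(3)[OF assms] this col_cell(2)[OF assms]]
  show "\<alpha>c c \<noteq> c" "\<alpha>c (\<alpha>c c) \<noteq> c" .
qed

text \<open>A row step keeps the row and a column step keeps the column, so any such coincidence
  would force a step that stays in place.\<close>

lemma row_col_neq:
  assumes "c \<in> B"
  shows "\<alpha>r c \<noteq> \<alpha>c c" "\<alpha>r (\<alpha>c c) \<noteq> c" "\<alpha>c (\<alpha>r c) \<noteq> c"
proof -
  show "\<alpha>r c \<noteq> \<alpha>c c"
    using assms fst_row[of c] snd_col[of c] row_neq(1)[of c] by (metis prod_eqI)
  show "\<alpha>r (\<alpha>c c) \<noteq> c"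
    using assms fst_row[of "\<alpha>c c"] snd_col[of c] col_neq(1)[of c] by (metis ord_in_iff(2) prod_eqI)
  show "\<alpha>c (\<alpha>r c) \<noteq> c"
    using assms snd_col[of "\<alpha>r c"] fst_row[of c] row_neq(1)[of c] by (metis ord_in_iff(1) prod_eqI)
qed

text \<open>
  The signed cell \<open>(c, True)\<close> stands for the entry \<open>x\<close> of the cell \<open>c\<close> and \<open>(c, False)\<close> for
  \<open>- x\<close>; thus \<open>rot\<close> is \<open>\<rho>\<^sub>0\<close> transported to signed cells.
\<close>

abbreviation P :: "(cell \<times> bool) set" where "P \<equiv> B \<times> UNIV"

definition rot :: "cell \<times> bool \<Rightarrow> cell \<times> bool" where
  "rot p = (if snd p then (\<alpha>r (fst p), False) else (\<alpha>c (fst p), True))"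

lemma P_iff: "p \<in> P \<longleftrightarrow> fst p \<in> B" by (cases p) auto

lemma rot_in_iff [simp]: "fst (rot p) \<in> B \<longleftrightarrow> fst p \<in> B" by (simp add: rot_def)

lemma snd_rot [simp]: "snd (rot p) = (\<not> snd p)" by (simp add: rot_def)

lemma rot_inj: "rot p = rot q \<longleftrightarrow> p = q"
  using inj_eq[OF permutes_inj[OF row_perm]] inj_eq[OF permutes_inj[OF col_perm]]
  by (cases p; cases q) (simp add: rot_def)

lemma finite_P: "finite P" and card_P: "card P = 2 * card B"
  using finite_B by (simp_all add: card_cartesian_product)

text \<open>On negative signed cells, two steps of \<open>rot\<close> act as
  \<open>\<alpha>r \<circ> \<alpha>c\<close>; compatibility therefore makes \<open>rot\<close> a
  single cycle through all of \<open>P\<close>.\<close>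

lemma rot_closed_eq_P:
  assumes A: "A \<subseteq> P" "A \<noteq> {}" and closed: "\<And>p. p \<in> A \<Longrightarrow> rot p \<in> A"
  shows "A = P"
proof -
  have "\<exists>c. (c, False) \<in> A"
  proof -
    obtain c b where cb: "(c, b) \<in> A" using A by auto
    have "rot (c, True) = (\<alpha>r c, False)" by (simp add: rot_def)
    then show ?thesis using cb closed[OF cb] by (cases b) metis+
  qed
  then obtain c0 where c0: "(c0, False) \<in> A" ..
  then have "c0 \<in> B" using A by auto
  then have B: "B = orbit (\<alpha>r \<circ> \<alpha>c) c0" using compat by (simp add: compatible_def cyclic_on_alldef)
  have step: "((\<alpha>r \<circ> \<alpha>c) c, False) \<in> A" if "(c, False) \<in> A" for c
    using closed[OF closed[OF that]] by (simp add: rot_def)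
  have "(c, False) \<in> A" if "c \<in> orbit (\<alpha>r \<circ> \<alpha>c) c0" for c
    using that by induction (use c0 step in auto)
  then have F: "(c, False) \<in> A" if "c \<in> B" for c using that B by simp
  have T: "(c, True) \<in> A" if "c \<in> B" for c
  proof -
    obtain c' where c': "c = \<alpha>c c'" using permutes_surj[OF col_perm] by (metis surjD)
    then have "c' \<in> B" using that by simp
    from closed[OF F[OF this]] show ?thesis by (simp add: rot_def c')
  qed
  have "(c, b) \<in> A" if "c \<in> B" for c b using F[OF that] T[OF that] by (cases b) auto
  then show ?thesis using A(1) by auto
qed

text \<open>
  The elements of the dihedral group generated by \<open>rot\<close>: the rotations for \<open>e\<close> true, the
  reflections otherwise.
\<close>

definition dih :: "bool \<Rightarrow> (cell \<times> bool \<Rightarrow> cell \<times> bool) \<Rightarrow> bool" where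
  "dih e M \<longleftrightarrow> (\<forall>p\<in>P. M p \<in> P) \<and> inj_on M P \<and>
     (\<forall>p\<in>P. if e then M (rot p) = rot (M p) else rot (M (rot p)) = M p)"

lemma dih_rot:
  assumes "dih e M" "p \<in> P"
  shows "M p \<in> P" "e \<Longrightarrow> M (rot p) = rot (M p)" "\<not> e \<Longrightarrow> rot (M (rot p)) = M p"
  using assms unfolding dih_def by meson+

text \<open>The points where \<open>M\<close> and \<open>M'\<close> agree are closed under
  \<open>rot\<close>, hence all of \<open>P\<close> as soon as there is one. A dihedral element is
  thus known on \<open>P\<close> from its type and a single value.\<close>

lemma dih_unique:
  assumes M: "dih e M" "dih e M'" and q: "q \<in> P" "M q = M' q" and p: "p \<in> P"
  shows "M p = M' p"
proof -
  have "{p \<in> P. M p = M' p} = P"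
  proof (rule rot_closed_eq_P)
    fix p assume "p \<in> {p \<in> P. M p = M' p}"
    then have p: "p \<in> P" "M p = M' p" by auto
    have "M (rot p) = M' (rot p)"
    proof (cases e)
      case True
      then show ?thesis using p dih_rot(2)[OF M(1) p(1) True] dih_rot(2)[OF M(2) p(1) True] by simp
    next
      case False
      then have "rot (M (rot p)) = rot (M' (rot p))" 
        using p dih_rot(3)[OF M(1) p(1) False] dih_rot(3)[OF M(2) p(1) False] by simp
      then show ?thesis by (simp add: rot_inj)
    qed
    then show "rot p \<in> {p \<in> P. M p = M' p}" using p by (simp add: P_iff)
  qed (use q in auto)
  then show ?thesis using p by blast
qed

section \<open>Cells moved by dihedral elements\<close>

lemma same_cell: "fst p = fst q \<Longrightarrow> p = q \<or> p = flip q"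
  by (cases p; cases q) (auto simp: flip_def)

text \<open>Coincidences to be ruled out below. The second would close a row or column after two
  steps, the first and third compare row steps with column steps, and the last two fail by sign
  alone.\<close>

lemma rot_facts:
  assumes "p \<in> P"
  shows "rot (flip p) \<noteq> flip (rot p)" "rot (flip (rot p)) \<noteq> flip p" "rot (rot p) \<noteq> p"
    "rot (flip (rot p)) \<noteq> p" "rot (rot p) \<noteq> flip p"
proof -
  obtain c b where p: "p = (c, b)" by (cases p)
  then have c: "c \<in> B" using assms by simp
  note neq = row_neq[OF c] col_neq[OF c] row_col_neq[OF c]
  show "rot (flip p) \<noteq> flip (rot p)" "rot (flip (rot p)) \<noteq> flip p" "rot (rot p) \<noteq> p"
    using neq by (simp_all add: p rot_def flip_def)
  show "rot (flip (rot p)) \<noteq> p" "rot (rot p) \<noteq> flip p"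
    by (auto dest!: arg_cong[of _ _ snd])
qed

text \<open>A nontrivial rotation fixes no signed cell, so keeping both cells would mean flipping
  both, but \<open>flip\<close> does not commute with \<open>rot\<close>. For a reflection, all four
  sign patterns contradict \<open>rot_facts\<close>.\<close>

lemma dih_moves_consecutive:
  assumes M: "dih e M" and nontriv: "\<exists>q\<in>P. M q \<noteq> q" and p: "p \<in> P"
  shows "fst (M p) \<noteq> fst p \<or> fst (M (rot p)) \<noteq> fst (rot p)"
proof (rule ccontr)
  assume "\<not> ?thesis"
  then have a: "M p = p \<or> M p = flip p" "M (rot p) = rot p \<or> M (rot p) = flip (rot p)"
    using same_cell by blast+
  show False
  proof (cases e)
    case True
    have id: "dih True id" by (simp add: dih_def)
    have nf: "M q \<noteq> q" if "q \<in> P" for q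
    proof
      assume Mq: "M q = q"
      obtain q' where q': "q' \<in> P" "M q' \<noteq> q'" using nontriv by blast
      have "M q' = id q'"
        by (rule dih_unique[OF _ id that _ q'(1)]) (use M True Mq in simp_all)
      then show False using q' by simp
    qed
    have "rot p \<in> P" using p by (simp add: P_iff)
    with a nf p have "M p = flip p" "M (rot p) = flip (rot p)" by auto
    moreover have "M (rot p) = rot (M p)" by (rule dih_rot(2)[OF M p True])
    ultimately show False using rot_facts(1)[OF p] by simp
  next
    case False
    have "rot (M (rot p)) = M p" by (rule dih_rot(3)[OF M p False])
    then show False using a rot_facts[OF p] by auto
  qed
qed

lemma card_inj_preimage:
  assumes "inj_on f P" "finite S"
  shows "card {p \<in> P. f p \<in> S} \<le> card S"
  by (rule card_inj_on_le[of f]) (use assms in \<open>auto simp: inj_on_def\<close>)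

text \<open>Each cell carries two signs and \<open>M\<close> is injective, so either alternative
  accounts for at most \<open>2 * card Z\<close> signed cells.\<close>

lemma card_touching:
  assumes M: "dih e M" and Z: "finite Z"
  shows "card {p \<in> P. fst p \<in> Z \<or> fst (M p) \<in> Z} \<le> 4 * card Z"
proof -
  let ?ZZ = "Z \<times> (UNIV :: bool set)"
  have ZZ: "finite ?ZZ" "card ?ZZ = 2 * card Z" using Z by (simp_all add: card_cartesian_product)
  have "{p \<in> P. fst p \<in> Z \<or> fst (M p) \<in> Z} = {p \<in> P. p \<in> ?ZZ} \<union> {p \<in> P. M p \<in> ?ZZ}"
    by (auto simp: mem_Times_iff)
  then have "card {p \<in> P. fst p \<in> Z \<or> fst (M p) \<in> Z}
      \<le> card {p \<in> P. p \<in> ?ZZ} + card {p \<in> P. M p \<in> ?ZZ}"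
    by (simp only: card_Un_le)
  then show ?thesis
    using card_inj_preimage[of "\<lambda>p. p" ?ZZ] card_inj_preimage[of M ?ZZ] M ZZ by (simp add: dih_def)
qed

text \<open>Fewer than \<open>card P\<close> signed cells \<open>p\<close> have \<open>p\<close> or
  \<open>rot p\<close> touching \<open>Z\<close>, directly or through \<open>M\<close>; for any
  other \<open>p\<close>, one of \<open>p\<close> and \<open>rot p\<close> is moved to a different
  cell.\<close>

lemma dih_choice:
  assumes M: "dih e M" and nontriv: "\<exists>q\<in>P. M q \<noteq> q" and Z: "finite Z" "4 * card Z < card B"
  obtains i where "i \<in> P" "fst i \<notin> Z" "fst (M i) \<notin> Z" "fst (M i) \<noteq> fst i"
proof -
  define W where "W = {p \<in> P. fst p \<in> Z \<or> fst (M p) \<in> Z}"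
  have W: "finite W" by (rule finite_subset[OF _ finite_P]) (auto simp: W_def)
  have cW: "card W \<le> 4 * card Z" unfolding W_def by (rule card_touching[OF M Z(1)])
  have "card (W \<union> {p \<in> P. rot p \<in> W}) \<le> card W + card {p \<in> P. rot p \<in> W}"
    by (rule card_Un_le)
  also have "\<dots> \<le> 8 * card Z"
    using card_inj_preimage[of rot W] W cW by (simp add: inj_on_def rot_inj)
  also have "\<dots> < card P" using Z by (simp add: card_P)
  finally have less: "card (W \<union> {p \<in> P. rot p \<in> W}) < card P" .
  have fin: "finite (W \<union> {p \<in> P. rot p \<in> W})"
    by (rule finite_subset[OF _ finite_P]) (auto simp: W_def)
  obtain p where p: "p \<in> P" "p \<notin> W" "rot p \<notin> W"
  proof -
    have "\<not> P \<subseteq> W \<union> {p \<in> P. rot p \<in> W}"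
    proof
      assume "P \<subseteq> W \<union> {p \<in> P. rot p \<in> W}"
      from card_mono[OF fin this] less show False by simp
    qed
    then show ?thesis using that by auto
  qed
  have rp: "rot p \<in> P" using p by (simp add: P_iff)
  have out: "fst q \<notin> Z \<and> fst (M q) \<notin> Z" if "q \<in> P" "q \<notin> W" for q
    using that by (auto simp only: W_def)
  from dih_moves_consecutive[OF M nontriv p(1)] show thesis
    using that[OF p(1)] that[OF rp] out[OF p(1,2)] out[OF rp p(3)] by blast
qed

end

section \<open>Arrays with prescribed entries\<close>

lemma neg_mod_neg_mod: "x \<in> Zmod v \<Longrightarrow> neg_mod v (neg_mod v x) = x"
  by (simp add: neg_mod_def Zmod_def mod_minus_eq)

lemma neg_mod_eq_iff: "x \<in> Zmod v \<Longrightarrow> y \<in> Zmod v \<Longrightarrow> neg_mod v x = neg_mod v y \<longleftrightarrow> x = y"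
  by (metis neg_mod_neg_mod)

lemma neg_mod_cong: "[neg_mod v x = - x] (mod int v)"
  by (simp add: neg_mod_def cong_def)

lemma Zmod_cong_eq: "x \<in> Zmod v \<Longrightarrow> y \<in> Zmod v \<Longrightarrow> [x = y] (mod int v) \<Longrightarrow> x = y"
  by (simp add: Zmod_def cong_def)

text \<open>\<open>covers_once\<close> speaks only of elements outside \<open>Jsub v t\<close>; the
  equality of multisets in \<open>\<Omega>_pm\<close> also keeps the subgroup out of
  \<open>\<Omega>\<close>. It is obtained by comparing sizes in
  \<open>quasi_heffter_pm_mset\<close>.\<close>

locale heffter = orderings +
  fixes t v :: nat and \<Omega> :: "int set"
  assumes t_pos: "t > 0" and t_dvd: "t dvd 2 * n * k" and v_def: "v = 2 * n * k + t"
    and \<Omega>_pm: "pm_mset v (mset_set \<Omega>) = mset_set (Zmod v - Jsub v t)"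
    and finite_\<Omega>: "finite \<Omega>" and card_\<Omega>: "card B = card \<Omega>"
begin

abbreviation J :: "int set" where "J \<equiv> Jsub v t"
abbreviation X :: "int set" where "X \<equiv> Zmod v - J"

lemma v_pos: "v > 0" using t_pos by (simp add: v_def)

lemma finite_Zmod: "finite (Zmod v)" by (simp add: Zmod_def)

lemma X_count: "x \<in> X \<Longrightarrow> count (mset_set \<Omega> + image_mset (neg_mod v) (mset_set \<Omega>)) x = 1"
  using \<Omega>_pm finite_Zmod by (simp add: pm_mset_def)

lemma X_eq: "X = \<Omega> \<union> neg_mod v ` \<Omega>"
proof -
  have "set_mset (pm_mset v (mset_set \<Omega>)) = X"
    unfolding \<Omega>_pm using finite_Zmod by (subst finite_set_mset_mset_set) auto
  then show ?thesis using finite_\<Omega> by (simp add: pm_mset_def)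
qed

text \<open>Otherwise \<open>x\<close> would occur both in \<open>\<Omega>\<close> and among the
  negatives, hence twice in a multiset that covers it once.\<close>

lemma \<Omega>_disjoint: "x \<in> \<Omega> \<Longrightarrow> neg_mod v x \<notin> \<Omega>"
proof
  assume x: "x \<in> \<Omega>" "neg_mod v x \<in> \<Omega>"
  then have "x \<in> X" using X_eq by blast
  then have c: "count (mset_set \<Omega> + image_mset (neg_mod v) (mset_set \<Omega>)) x = 1" by (rule X_count)
  have "neg_mod v (neg_mod v x) = x" using \<open>x \<in> X\<close> by (simp add: neg_mod_neg_mod)
  then have "x \<in># image_mset (neg_mod v) (mset_set \<Omega>)" using x finite_\<Omega> by force
  then have "count (image_mset (neg_mod v) (mset_set \<Omega>)) x \<ge> 1"
    by (rule count_greater_eq_one_iff[THEN iffD2])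
  moreover have "count (mset_set \<Omega>) x = 1" using x finite_\<Omega> by simp
  ultimately show False using c unfolding count_union by linarith
qed

definition val :: "pf_array \<Rightarrow> cell \<times> bool \<Rightarrow> int" where
  "val D p = (if snd p then the (D (fst p)) else neg_mod v (the (D (fst p))))"

lemma val_cong: "D (fst p) = D' (fst p) \<Longrightarrow> val D p = val D' p"
  by (simp add: val_def)

lemma bijs_value:
  assumes "D \<in> bijs B \<Omega>" "c \<in> B"
  shows "D c = Some (the (D c))" "the (D c) \<in> \<Omega>"
proof -
  have "D c \<in> Some ` \<Omega>" using bijs_image[OF assms(1)] assms(2) by blast
  then show "D c = Some (the (D c))" "the (D c) \<in> \<Omega>" by auto
qed

lemma val_in_X:
  assumes "D \<in> bijs B \<Omega>" "p \<in> P"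
  shows "val D p \<in> X"
proof -
  have "the (D (fst p)) \<in> \<Omega>" using bijs_value(2)[OF assms(1), of "fst p"] assms(2) by auto
  then show ?thesis unfolding X_eq by (simp add: val_def)
qed

lemma val_in_Zmod: "D \<in> bijs B \<Omega> \<Longrightarrow> p \<in> P \<Longrightarrow> val D p \<in> Zmod v"
  using val_in_X by blast

lemma val_flip:
  assumes "D \<in> bijs B \<Omega>" "p \<in> P"
  shows "val D (flip p) = neg_mod v (val D p)"
proof -
  have "the (D (fst p)) \<in> Zmod v"
    using bijs_value[OF assms(1), of "fst p"] assms(2) X_eq by (auto simp: P_iff)
  then show ?thesis by (simp add: val_def neg_mod_neg_mod)
qed

text \<open>Entries are canonical residues, so a value modulo \<open>v\<close> at either sign pins
  down the entry itself. This turns congruences into determined cells.\<close>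

lemma val_determines:
  assumes D: "D \<in> bijs B \<Omega>" "D' \<in> bijs B \<Omega>" and p: "p \<in> P" and eq: "[val D p = val D' p] (mod int v)"
  shows "D (fst p) = D' (fst p)"
proof -
  have c: "fst p \<in> B" using p by auto
  note v1 = bijs_value[OF D(1) c] and v2 = bijs_value[OF D(2) c]
  have Z: "the (D (fst p)) \<in> Zmod v" "the (D' (fst p)) \<in> Zmod v" using v1(2) v2(2) X_eq by blast+
  have "val D p = val D' p" 
    by (rule Zmod_cong_eq[OF val_in_Zmod[OF D(1) p] val_in_Zmod[OF D(2) p] eq])
  then have "the (D (fst p)) = the (D' (fst p))"
    using neg_mod_eq_iff[OF Z] by (cases "snd p") (simp_all add: val_def)
  then show ?thesis using v1(1) v2(1) by simp
qed

text \<open>Signed cells enumerate the neighbours of 0: \<open>\<Omega>\<close> and its negatives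
  are disjoint and together exhaust \<open>X\<close>.\<close>

lemma val_bij:
  assumes D: "D \<in> bijs B \<Omega>"
  shows "bij_betw (val D) P X"
  unfolding bij_betw_def
proof
  show "inj_on (val D) P"
  proof (rule inj_onI)
    fix p q assume p: "p \<in> P" and q: "q \<in> P" and eq: "val D p = val D q"
    have c: "fst p \<in> B" "fst q \<in> B" using p q by auto
    note v1 = bijs_value[OF D c(1)] and v2 = bijs_value[OF D c(2)]
    have Z: "the (D (fst p)) \<in> Zmod v" "the (D (fst q)) \<in> Zmod v" using v1(2) v2(2) X_eq by blast+
    have "snd p = snd q \<and> x = y"
      if "(if snd p then x else neg_mod v x) = (if snd q then y else neg_mod v y)"
        "x \<in> \<Omega>" "y \<in> \<Omega>" "neg_mod v x \<notin> \<Omega>" "neg_mod v y \<notin> \<Omega>"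
        "neg_mod v x = neg_mod v y \<longleftrightarrow> x = y" for x y
      using that by (auto split: if_splits)
    from this[OF eq[unfolded val_def] v1(2) v2(2) \<Omega>_disjoint[OF v1(2)] \<Omega>_disjoint[OF v2(2)]
        neg_mod_eq_iff[OF Z]]
    have "snd p = snd q \<and> the (D (fst p)) = the (D (fst q))" .
    then have "snd p = snd q" "D (fst p) = D (fst q)" using v1(1) v2(1) by auto
    then show "p = q"
      using inj_onD[OF bijs_inj_on[OF finite_B card_\<Omega> D] _ c] by (simp add: prod_eq_iff[of p])
  qed
  show "val D ` P = X"
  proof
    show "val D ` P \<subseteq> X" using val_in_X[OF D] by blast
    have "\<exists>c\<in>B. D c = Some w" if "w \<in> \<Omega>" for w
    proof -
      have "Some w \<in> D ` B" using that bijs_image[OF D] by blast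
      then show ?thesis by auto
    qed
    then have "w \<in> val D ` P \<and> neg_mod v w \<in> val D ` P" if w: "w \<in> \<Omega>" for w
    proof -
      obtain c where c: "c \<in> B" "D c = Some w" using w \<open>\<And>w. w \<in> \<Omega> \<Longrightarrow> \<exists>c\<in>B. D c = Some w\<close> by blast
      have "val D (c, True) = w" "val D (c, False) = neg_mod v w" using c by (simp_all add: val_def)
      moreover have "(c, True) \<in> P" "(c, False) \<in> P" using c by auto
      ultimately show ?thesis by (metis imageI)
    qed
    then show "X \<subseteq> val D ` P" using X_eq by blast
  qed
qed

text \<open>
  What survives in \<open>D\<close> of an automorphism fixing \<open>0\<close>: \<open>M\<close> is its action on the neighbours of
  \<open>0\<close>, and \<open>h\<close> its action around the vertex \<open>val D i\<close>, which is forced by the edge back to \<open>0\<close>.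
\<close>

definition good :: "pf_array \<Rightarrow> bool \<Rightarrow> (cell \<times> bool \<Rightarrow> cell \<times> bool) \<Rightarrow> bool" where
  "good D e M \<longleftrightarrow> (\<forall>i\<in>P. \<exists>h. dih e h \<and> h (flip i) = flip (M i) \<and>
     (\<forall>j\<in>P. (\<exists>y\<in>J. [val D i + val D j = y] (mod int v)) \<or>
        (\<exists>p\<in>P. [val D i + val D j = val D p] (mod int v) \<and>
               [val D (M i) + val D (h j) = val D (M p)] (mod int v))))"

definition sol :: "bool \<Rightarrow> (cell \<times> bool \<Rightarrow> cell \<times> bool) \<Rightarrow> pf_array set" where
  "sol e M = {D \<in> bijs B \<Omega>. good D e M}"

text \<open>
  Uniformity in up to \<open>z\<close> prescribed values is what allows gaining the factor \<open>1 / nk\<close> twice.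
\<close>

definition ext_bound :: "pf_array set \<Rightarrow> nat \<Rightarrow> real \<Rightarrow> bool" where
  "ext_bound S z b \<longleftrightarrow> (\<forall>Z \<phi>. Z \<subseteq> B \<longrightarrow> card Z \<le> z \<longrightarrow>
     real (card {D \<in> S. \<forall>c\<in>Z. D c = \<phi> c}) \<le> b * fact (card B - card Z))"

lemma ext_bound_trivial:
  assumes S: "S \<subseteq> bijs B \<Omega>"
  shows "ext_bound S z 1"
  unfolding ext_bound_def
proof (intro allI impI)
  fix Z and \<phi> :: "cell \<Rightarrow> int option" assume Z: "Z \<subseteq> B"
  have "card {D \<in> S. \<forall>c\<in>Z. D c = \<phi> c} \<le> card {D \<in> bijs B \<Omega>. \<forall>c\<in>Z. D c = \<phi> c}"
    by (rule card_mono[OF card_bijs_extending(1)[OF finite_B card_\<Omega> Z]]) (use S in auto)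
  also have "\<dots> \<le> fact (card B - card Z)"
    by (rule card_bijs_extending(2)[OF finite_B card_\<Omega> Z])
  finally have "real (card {D \<in> S. \<forall>c\<in>Z. D c = \<phi> c}) \<le> real (fact (card B - card Z))"
    by (rule of_nat_mono)
  then show "real (card {D \<in> S. \<forall>c\<in>Z. D c = \<phi> c}) \<le> 1 * fact (card B - card Z)"
    by (simp only: of_nat_fact mult_1)
qed

text \<open>This is \<open>card_bijs_determined\<close> with \<open>U\<close> as \<open>S\<close>:
  every cell of \<open>R\<close> is solved from a congruence in the other cells of \<open>U\<close>
  and gains a factor \<open>1 / card B\<close>. As \<open>U\<close> may exceed \<open>Z\<close> by
  six cells, the assumed bound must allow \<open>z + 6\<close> of them.\<close>

lemma ext_bound_determined:
  assumes S: "S \<subseteq> bijs B \<Omega>" and bd: "ext_bound S (z + 6) b" and b: "0 \<le> b"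
    and Z: "Z \<subseteq> B" "card Z \<le> z" and big: "2 * (z + 6) \<le> card B"
    and \<A>: "\<A> \<subseteq> {D \<in> S. \<forall>c\<in>Z. D c = \<phi> c}"
    and U: "Z \<subseteq> U" "U \<subseteq> B" "card U \<le> card Z + d" "d \<le> 6" and R: "R \<subseteq> U - Z"
    and det: "\<And>x. x \<in> R \<Longrightarrow> \<exists>p F. fst p = x \<and> (\<forall>D\<in>\<A>. [val D p = F D] (mod int v)) \<and>
        (\<forall>D D'. (\<forall>c\<in>U - R. D c = D' c) \<longrightarrow> F D = (F D' :: int))"
  shows "real (card \<A>) \<le> b * fact (card B - card Z) * 2 ^ d / real (card B) ^ card R"
proof -
  define e where "e = card (U - Z)"
  have finU: "finite U" "finite Z" using U finite_B finite_subset by metis+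
  have e: "card U = card Z + e" "e \<le> d"
    using U finU by (auto simp: e_def card_Diff_subset card_mono)
  have cT: "card (U - Z - R) + card R = e"
    using R finU card_Diff_subset[of R "U - Z"] card_mono[of "U - Z" R] finite_subset[of R "U - Z"]
    by (simp add: e_def)
  have "real (card \<A>) \<le> b * fact (card B - card Z) * 2 ^ e / real (card B) ^ card R"
  proof (rule card_bijs_determined[OF finite_B card_\<Omega> _ U(2)])
    show "\<A> \<subseteq> bijs B \<Omega>" using \<A> S by blast
    show "U - Z - R \<subseteq> U" by blast
    show "\<forall>c\<in>U. D c = D' c" if D: "D \<in> \<A>" "D' \<in> \<A>" and agree: "\<forall>c\<in>U - Z - R. D c = D' c" for D D'
    proof -
      have UR: "\<forall>c\<in>U - R. D c = D' c"
      proof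
        fix c assume c: "c \<in> U - R"
        show "D c = D' c"
        proof (cases "c \<in> Z")
          case True
          then have "D c = \<phi> c" "D' c = \<phi> c" using D \<A> by blast+
          then show ?thesis by simp
        qed (use c agree in blast)
      qed
      have "D x = D' x" if x: "x \<in> R" for x
      proof -
        obtain p F where p: "fst p = x" "[val D p = F D] (mod int v)" "[val D' p = F D'] (mod int v)"
            "F D = F D'"
        proof -
          obtain p F where "fst p = x" "\<forall>D\<in>\<A>. [val D p = F D] (mod int v)"
              "\<forall>D D'. (\<forall>c\<in>U - R. D c = D' c) \<longrightarrow> F D = F D'"
            using det[OF x] by blast
          then show ?thesis using that[of p F] D UR by blast
        qed
        have "p \<in> P" using p(1) x R U(2) by (auto simp: P_iff)
        moreover have "[val D p = val D' p] (mod int v)" using p by (metis cong_sym cong_trans)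
        ultimately show ?thesis using val_determines[of D D' p] D \<A> S p(1) by blast
      qed
      then show ?thesis using UR by blast
    qed
    show "real (card {D' \<in> \<A>. \<forall>c\<in>U. D' c = D c}) \<le> b * fact (card B - card U)" if D: "D \<in> \<A>" for D
    proof -
      have fin: "finite {D' \<in> S. \<forall>c\<in>U. D' c = D c}"
        by (rule finite_subset[OF _ finite_bijs[OF finite_B card_\<Omega>]]) (use S in auto)
      have "card {D' \<in> \<A>. \<forall>c\<in>U. D' c = D c} \<le> card {D' \<in> S. \<forall>c\<in>U. D' c = D c}"
        by (rule card_mono[OF fin]) (use \<A> in auto)
      moreover have "real (card {D' \<in> S. \<forall>c\<in>U. D' c = D c}) \<le> b * fact (card B - card U)"
        using bd U Z unfolding ext_bound_def by auto
      ultimately show ?thesis by linarith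
    qed
    show "0 \<le> b" by (rule b)
    show "card U = card Z + e" "card (U - Z - R) + card R = e" by (rule e(1) cT)+
    show "2 * (card Z + e) \<le> card B" "0 < card B" using big Z(2) e U(4) by auto
  qed
  also have "\<dots> \<le> b * fact (card B - card Z) * 2 ^ d / real (card B) ^ card R"
    using b e by (intro divide_right_mono mult_left_mono power_increasing) auto
  finally show ?thesis .
qed

end

lemma cong_add_move: "[a + b = c] (mod m) \<Longrightarrow> [a = c - b] (mod m)" for a b c m :: int
  using cong_diff[of "a + b" c m b b] by simp

text \<open>With \<open>v = t * (d + 1)\<close>, the subgroup consists of the multiples of
  \<open>d + 1\<close>, and \<open>(d + 1) * x\<close> modulo \<open>v\<close> depends only on
  \<open>x\<close> modulo \<open>t\<close>.\<close>

lemma card_Jsub: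
  assumes t_pos: "t > 0" and t_dvd: "t dvd w" and v_def: "v = w + t"
  shows "card (Jsub v t) = t"
proof -
  obtain d where d: "w = t * d" using t_dvd by blast
  then have v: "v = t * Suc d" by (simp add: v_def)
  have vt: "v div t = Suc d" using t_pos by (simp add: v)
  have "Jsub v t = (\<lambda>x. int (Suc d) * x) ` {0..<int t}"
  proof
    show "Jsub v t \<subseteq> (\<lambda>x. int (Suc d) * x) ` {0..<int t}"
    proof
      fix y assume "y \<in> Jsub v t"
      then obtain x where "y = (int (Suc d) * x) mod int v" by (auto simp: Jsub_def vt)
      then have "y = int (Suc d) * (x mod int t)"
        by (simp only: v of_nat_mult mult.commute[of "int t"] mult_mod_right)
      then show "y \<in> (\<lambda>x. int (Suc d) * x) ` {0..<int t}" using t_pos by simp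
    qed
    show "(\<lambda>x. int (Suc d) * x) ` {0..<int t} \<subseteq> Jsub v t"
    proof
      fix y assume "y \<in> (\<lambda>x. int (Suc d) * x) ` {0..<int t}"
      then obtain x where x: "y = int (Suc d) * x" "0 \<le> x" "x < int t" by auto
      then have "y = int (Suc d) * (x mod int t)" by simp
      then have "y = (int (Suc d) * x) mod int v"
        by (simp only: v of_nat_mult mult.commute[of "int t"] mult_mod_right)
      moreover have "x \<in> Zmod v" using x by (auto simp: Zmod_def v algebra_simps intro: less_le_trans)
      ultimately show "y \<in> Jsub v t" unfolding Jsub_def vt by blast
    qed
  qed
  moreover have "inj_on (\<lambda>x. int (Suc d) * x) {0..<int t}" by (auto simp: inj_on_def)
  ultimately show ?thesis by (simp add: card_image)
qed

section \<open>Gaining one factor of order 1/nk\<close>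

context heffter
begin

lemma card_J: "card J = t"
  by (rule card_Jsub[OF t_pos t_dvd v_def])

lemma finite_J: "finite J" by (simp add: Jsub_def Zmod_def)

text \<open>Signed cells \<open>i\<close> and \<open>j\<close> moved by \<open>M\<close> and by the
  induced \<open>h\<close>, chosen away from \<open>Z\<close>, give one relation to count. In the
  constant, \<open>16 * t\<close> comes from sums in \<open>J\<close>, \<open>64 * (z + 4)\<close>
  from exceptional \<open>p\<close>, where one equation is used, and \<open>128\<close> from the
  other \<open>p\<close>, where two are. The bound on \<open>z\<close> covers both choices and the
  \<open>z + 6\<close> cells involved.\<close>

lemma ext_bound_step:
  fixes z :: nat and b :: real
  assumes M: "dih e M" and nontriv: "\<exists>q\<in>P. M q \<noteq> q"
    and bd: "ext_bound (sol e M) (z + 6) b" and b: "0 \<le> b" and big: "4 * z + 16 < card B"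
  shows "ext_bound (sol e M) z ((16 * t + 64 * (z + 4) + 128) * b / card B)"
  unfolding ext_bound_def
proof (intro allI impI)
  fix Z and \<phi> :: "cell \<Rightarrow> int option" assume Z: "Z \<subseteq> B" "card Z \<le> z"
  define \<A> where "\<A> = {D \<in> sol e M. \<forall>c\<in>Z. D c = \<phi> c}"
  define N where "N = real (card B)"
  define f where "f = (fact (card B - card Z) :: real)"
  have N: "N > 0" using big by (simp add: N_def)
  have f: "f > 0" by (simp add: f_def)
  have finZ: "finite Z" using Z(1) finite_B finite_subset by metis
  have sol: "sol e M \<subseteq> bijs B \<Omega>" by (auto simp: sol_def)
  have \<A>_bijs: "D \<in> bijs B \<Omega>" if "D \<in> \<A>" for D using that sol by (auto simp: \<A>_def)
  have "real (card \<A>) \<le> (16 * t + 64 * (z + 4) + 128) * b / N * f"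
  proof (cases "\<A> = {}")
    case True
    then show ?thesis using b N f by simp
  next
    case False
    then obtain D0 where D0: "D0 \<in> \<A>" by blast
    have "4 * card Z < card B" using Z(2) big by linarith
    from dih_choice[OF M nontriv finZ this]
    obtain i where i: "i \<in> P" "fst i \<notin> Z" "fst (M i) \<notin> Z" "fst (M i) \<noteq> fst i" by blast
    have "good D0 e M" using D0 by (simp add: \<A>_def sol_def)
    then obtain h where h: "dih e h" "h (flip i) = flip (M i)"
      unfolding good_def using i(1) by blast
    have fi: "flip i \<in> P" using i(1) by (simp add: P_iff)
    \<comment> \<open>Since \<open>h\<close> sends \<open>flip i\<close> to
      \<open>flip (M i)\<close>, which lies in a different cell, \<open>h\<close> is nontrivial and
      \<open>dih_choice\<close> applies a second time.\<close>
    have "h (flip i) \<noteq> flip i" 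
    proof
      assume "h (flip i) = flip i"
      then have "fst (flip (M i)) = fst (flip i)" by (simp add: h(2))
      then show False using i(4) by simp
    qed
    then have h_nontriv: "\<exists>q\<in>P. h q \<noteq> q" using fi by (rule bexI)
    have "card (insert (fst i) (insert (fst (M i)) Z)) \<le> z + 2"
      using Z(2) finZ i by (simp add: card_insert_if)
    then have "4 * card (insert (fst i) (insert (fst (M i)) Z)) < card B" using big by linarith
    from dih_choice[OF h(1) h_nontriv _ this] finZ
    obtain j where j: "j \<in> P" "fst j \<notin> insert (fst i) (insert (fst (M i)) Z)"
      "fst (h j) \<notin> insert (fst i) (insert (fst (M i)) Z)" "fst (h j) \<noteq> fst j" by blast
    have Mi: "M i \<in> P" and hj: "h j \<in> P" using dih_rot(1) M h(1) i(1) j(1) by blast+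
    define U where "U = Z \<union> {fst i, fst (M i), fst j, fst (h j)}"
    have U: "Z \<subseteq> U" "U \<subseteq> B" using i(1) j(1) Mi hj Z(1) by (auto simp: U_def P_iff)
    have cU: "card U \<le> card Z + 4"
      unfolding U_def by (rule order_trans[OF card_Un_le]) (simp add: card_insert_if)
    have finU: "finite U" using finZ by (simp add: U_def)
    note det_bound = ext_bound_determined[OF sol bd b Z]
    have big': "2 * (z + 6) \<le> card B" using big by simp

    define \<J> where "\<J> y = {D \<in> \<A>. [val D i + val D j = y] (mod int v)}" for y
    define \<P> where "\<P> p = {D \<in> \<A>. [val D i + val D j = val D p] (mod int v) \<and>
      [val D (M i) + val D (h j) = val D (M p)] (mod int v)}" for p

    have cover: "\<A> \<subseteq> (\<Union>y\<in>J. \<J> y) \<union> (\<Union>p\<in>P. \<P> p)"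
    proof
      fix D assume D: "D \<in> \<A>"
      then have "good D e M" by (simp add: \<A>_def sol_def)
      then obtain h' where h': "dih e h'" "h' (flip i) = flip (M i)"
        "(\<exists>y\<in>J. [val D i + val D j = y] (mod int v)) \<or>
         (\<exists>p\<in>P. [val D i + val D j = val D p] (mod int v) \<and>
               [val D (M i) + val D (h' j) = val D (M p)] (mod int v))"
        unfolding good_def using i(1) j(1) by blast
      \<comment> \<open>The local action \<open>h'\<close> belongs to \<open>D\<close>, but its type
        and its value at \<open>flip i\<close> are prescribed, so it agrees with the
        \<open>h\<close> obtained from \<open>D0\<close>; one choice of \<open>j\<close> serves
        every array.\<close>
      have "h' j = h j" by (rule dih_unique[OF h'(1) h(1) fi _ j(1)]) (simp add: h'(2) h(2))
      then show "D \<in> (\<Union>y\<in>J. \<J> y) \<union> (\<Union>p\<in>P. \<P> p)"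
        using h'(3) D unfolding \<J>_def \<P>_def by auto
    qed

    \<comment> \<open>One congruence among the cells of \<open>U\<close> gains a factor
      \<open>1 / card B\<close>; the 16 is \<open>2 ^ 4\<close> for at most four new cells.\<close>
    have one: "real (card \<B>) \<le> 16 * b * f / N"
      if \<B>: "\<B> \<subseteq> \<A>" and x: "x \<in> U - Z" "fst p = x"
        and F: "\<And>D. D \<in> \<B> \<Longrightarrow> [val D p = F D] (mod int v)"
          "\<And>D D'. \<forall>c\<in>U - {x}. D c = D' c \<Longrightarrow> F D = (F D' :: int)" for \<B> x p F
    proof -
      have "real (card \<B>) \<le> b * fact (card B - card Z) * 2 ^ 4 / real (card B) ^ card {x}"
      proof (rule det_bound[OF big' _ U cU])
        show "\<B> \<subseteq> {D \<in> sol e M. \<forall>c\<in>Z. D c = \<phi> c}" using \<B> by (simp add: \<A>_def)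
        show "\<exists>p F. fst p = y \<and> (\<forall>D\<in>\<B>. [val D p = F D] (mod int v)) \<and>
            (\<forall>D D'. (\<forall>c\<in>U - {x}. D c = D' c) \<longrightarrow> F D = (F D' :: int))" if "y \<in> {x}" for y
          using that x F by (intro exI[of _ p] exI[of _ F]) auto
      qed (use x in auto)
      then show ?thesis by (simp add: f_def N_def mult_ac)
    qed

    have bound_\<J>: "real (card (\<J> y)) \<le> 16 * b * f / N" for y
    proof (rule one[where x = "fst i" and p = i and F = "\<lambda>D. y - val D j"])
      show "\<J> y \<subseteq> \<A>" by (auto simp: \<J>_def)
      show "fst i \<in> U - Z" using i by (simp add: U_def)
      show "[val D i = y - val D j] (mod int v)" if "D \<in> \<J> y" for D
        using that by (intro cong_add_move) (simp add: \<J>_def)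
      show "y - val D j = y - val D' j" if "\<forall>c\<in>U - {fst i}. D c = D' c" for D D'
        using val_cong[of D j D'] that j(2) by (simp add: U_def)
    qed simp

    \<comment> \<open>The congruence is solved for the cell of \<open>p\<close>, unless
      \<open>r\<close> lies there too; then it is solved for the cell of \<open>q\<close>, which is
      a different one.\<close>
    have equation: "real (card \<B>) \<le> 16 * b * f / N"
      if \<B>: "\<B> \<subseteq> {D \<in> \<A>. [val D p + val D q = val D r] (mod int v)}"
        and pq: "fst p \<in> U - Z" "fst q \<in> U - Z" "fst p \<noteq> fst q" "fst r \<in> U" for \<B> p q r
    proof (cases "fst r = fst p")
      case False
      show ?thesis
      proof (rule one[where x = "fst p" and p = p and F = "\<lambda>D. val D r - val D q"])
        show "[val D p = val D r - val D q] (mod int v)" if "D \<in> \<B>" for D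
          using that \<B> by (intro cong_add_move) auto
        show "val D r - val D q = val D' r - val D' q" if "\<forall>c\<in>U - {fst p}. D c = D' c" for D D'
          using val_cong[of D r D'] val_cong[of D q D'] that pq False by simp
      qed (use \<B> pq in auto)
    next
      case True
      show ?thesis
      proof (rule one[where x = "fst q" and p = q and F = "\<lambda>D. val D r - val D p"])
        show "[val D q = val D r - val D p] (mod int v)" if "D \<in> \<B>" for D
          using that \<B> by (intro cong_add_move) (auto simp: add.commute)
        show "val D r - val D p = val D' r - val D' p" if "\<forall>c\<in>U - {fst q}. D c = D' c" for D D'
          using val_cong[of D r D'] val_cong[of D p D'] that pq True by simp
      qed (use \<B> pq in auto)
    qed

    \<comment> \<open>For these \<open>p\<close>, one of the two equations has all its cells in
      \<open>U\<close>, and that one alone is used.\<close>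
    define Q where "Q = {p \<in> P. fst p \<in> U \<or> fst (M p) \<in> U}"
    have Q: "card Q \<le> 4 * (z + 4)" "Q \<subseteq> P"
      using card_touching[OF M finU] cU Z(2) by (auto simp: Q_def)
    have bound_Q: "real (card (\<P> p)) \<le> 16 * b * f / N" if p: "p \<in> Q" for p
    proof -
      consider "fst p \<in> U" | "fst (M p) \<in> U" using p by (auto simp: Q_def)
      then show ?thesis
      proof cases
        case 1
        show ?thesis
          by (rule equation[of _ i j p]) (use 1 i j in \<open>auto simp: \<P>_def U_def\<close>)
      next
        case 2
        show ?thesis
          by (rule equation[of _ "M i" "h j" "M p"]) (use 2 i j in \<open>auto simp: \<P>_def U_def\<close>)
      qed
    qed

    \<comment> \<open>Here \<open>p\<close> and \<open>M p\<close> avoid \<open>U\<close>: the first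
      equation is solved for the cell of \<open>i\<close>, the second for that of
      \<open>M i\<close>, with at most six new cells.\<close>
    have bound_generic: "real (card (\<P> p)) \<le> 64 * b * f / N\<^sup>2" if p: "p \<in> P - Q" for p
    proof -
      define U' where "U' = U \<union> {fst p, fst (M p)}"
      have Mp: "M p \<in> P" using p dih_rot(1)[OF M] by blast
      have out: "fst p \<notin> U" "fst (M p) \<notin> U" using p by (auto simp: Q_def)
      let ?R = "{fst i, fst (M i)}"
      have "real (card (\<P> p)) \<le> b * fact (card B - card Z) * 2 ^ 6 / real (card B) ^ card ?R"
      proof (rule det_bound[OF big'])
        show "\<P> p \<subseteq> {D \<in> sol e M. \<forall>c\<in>Z. D c = \<phi> c}" by (auto simp: \<P>_def \<A>_def)
        show "Z \<subseteq> U'" "U' \<subseteq> B" using U p Mp by (auto simp: U'_def P_iff)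
        have "card U' \<le> card U + card {fst p, fst (M p)}" unfolding U'_def by (rule card_Un_le)
        also have "\<dots> \<le> card Z + 6" using cU by (simp add: card_insert_if)
        finally show "card U' \<le> card Z + 6" .
        show "?R \<subseteq> U' - Z" using i by (auto simp: U'_def U_def)
        show "\<exists>q F. fst q = y \<and> (\<forall>D\<in>\<P> p. [val D q = F D] (mod int v)) \<and>
            (\<forall>D D'. (\<forall>c\<in>U' - ?R. D c = D' c) \<longrightarrow> F D = (F D' :: int))" if y: "y \<in> ?R" for y
        proof -
          have "\<exists>q F. fst q = fst i \<and> (\<forall>D\<in>\<P> p. [val D q = F D] (mod int v)) \<and>
            (\<forall>D D'. (\<forall>c\<in>U' - ?R. D c = D' c) \<longrightarrow> F D = (F D' :: int))"
          proof (intro exI[of _ i] exI[of _ "\<lambda>D. val D p - val D j"] conjI ballI allI impI refl)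
            show "[val D i = val D p - val D j] (mod int v)" if "D \<in> \<P> p" for D
              using that by (intro cong_add_move) (simp add: \<P>_def)
            show "val D p - val D j = val D' p - val D' j" if "\<forall>c\<in>U' - ?R. D c = D' c" for D D'
              using val_cong[of D p D'] val_cong[of D j D'] that out j(2) by (simp add: U'_def U_def)
          qed
          moreover have "\<exists>q F. fst q = fst (M i) \<and> (\<forall>D\<in>\<P> p. [val D q = F D] (mod int v)) \<and>
            (\<forall>D D'. (\<forall>c\<in>U' - ?R. D c = D' c) \<longrightarrow> F D = (F D' :: int))"
          proof (intro exI[of _ "M i"] exI[of _ "\<lambda>D. val D (M p) - val D (h j)"] conjI ballI allI impI refl)
            show "[val D (M i) = val D (M p) - val D (h j)] (mod int v)" if "D \<in> \<P> p" for D
              using that by (intro cong_add_move) (simp add: \<P>_def)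
            show "val D (M p) - val D (h j) = val D' (M p) - val D' (h j)"
              if "\<forall>c\<in>U' - ?R. D c = D' c" for D D'
              using val_cong[of D "M p" D'] val_cong[of D "h j" D'] that out j(3)
              by (simp add: U'_def U_def)
          qed
          ultimately show ?thesis using y by auto
        qed
      qed simp
      moreover have "card ?R = 2" using i(4) by auto
      ultimately show ?thesis by (simp add: f_def N_def mult_ac)
    qed

    have sum_bound: "real (card (\<Union>x\<in>I. g x)) \<le> c * w"
      if "finite I" "\<And>x. x \<in> I \<Longrightarrow> real (card (g x)) \<le> w" "real (card I) \<le> c" "0 \<le> w"
      for I and g :: "_ \<Rightarrow> pf_array set" and c w
    proof -
      have "real (card (\<Union>x\<in>I. g x)) \<le> (\<Sum>x\<in>I. real (card (g x)))"
        using card_UN_le[OF that(1), of g] by (metis of_nat_mono of_nat_sum)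
      also have "\<dots> \<le> real (card I) * w" using that(2) by (intro sum_bounded_above)
      also have "\<dots> \<le> c * w" using that by (intro mult_right_mono)
      finally show ?thesis .
    qed
    have sJ: "real (card (\<Union>y\<in>J. \<J> y)) \<le> t * (16 * b * f / N)"
      by (rule sum_bound[OF finite_J bound_\<J>]) (use b f N card_J in auto)
    have sQ: "real (card (\<Union>p\<in>Q. \<P> p)) \<le> (4 * (z + 4)) * (16 * b * f / N)"
      by (rule sum_bound[OF finite_subset[OF Q(2) finite_P] bound_Q]) (use b f N Q(1) in auto)
    \<comment> \<open>There are at most \<open>2 * card B\<close> generic \<open>p\<close>, so the
      union over them costs one of the two factors gained.\<close>
    have sG: "real (card (\<Union>p\<in>P - Q. \<P> p)) \<le> (2 * N) * (64 * b * f / N\<^sup>2)"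
    proof (rule sum_bound[OF _ bound_generic])
      have "card (P - Q) \<le> card P" by (rule card_mono[OF finite_P]) blast
      then show "real (card (P - Q)) \<le> 2 * N" by (simp add: N_def card_P)
    qed (use b f N finite_P in auto)
    have eqP: "(\<Union>p\<in>P. \<P> p) = (\<Union>p\<in>Q. \<P> p) \<union> (\<Union>p\<in>P - Q. \<P> p)" using Q(2) by blast
    have fin: "finite \<A>"
      by (rule finite_subset[OF _ finite_bijs[OF finite_B card_\<Omega>]]) (use \<A>_bijs in blast)
    have "finite ((\<Union>y\<in>J. \<J> y) \<union> (\<Union>p\<in>P. \<P> p))"
      by (rule finite_subset[OF _ fin]) (auto simp: \<J>_def \<P>_def)
    from card_mono[OF this cover]
    have "card \<A> \<le> card (\<Union>y\<in>J. \<J> y) + (card (\<Union>p\<in>Q. \<P> p) + card (\<Union>p\<in>P - Q. \<P> p))"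
      unfolding eqP by (meson add_left_mono card_Un_le order_trans)
    then have "real (card \<A>) \<le> real (card (\<Union>y\<in>J. \<J> y)) + (real (card (\<Union>p\<in>Q. \<P> p))
        + real (card (\<Union>p\<in>P - Q. \<P> p)))" by linarith
    also have "\<dots> \<le> t * (16 * b * f / N) + ((4 * (z + 4)) * (16 * b * f / N)
        + (2 * N) * (64 * b * f / N\<^sup>2))" using sJ sQ sG by linarith
    also have "\<dots> = (16 * t + 64 * (z + 4) + 128) * b / N * f"
      using N by (simp add: field_simps power2_eq_square)
    finally show ?thesis .
  qed
  then show "real (card {D \<in> sol e M. \<forall>c\<in>Z. D c = \<phi> c})
      \<le> (16 * t + 64 * (z + 4) + 128) * b / card B * fact (card B - card Z)"
    by (simp add: \<A>_def N_def f_def)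
qed

end

section \<open>Counting bad arrays and arrays without zero sums\<close>

context orderings
begin

lemma card_B_rows: "card B = m * h"
proof -
  have "B = (\<Union>i<m. row_cells B i)" using row_cell(1) by (auto simp: row_cells_def)
  then have "card B = card (\<Union>i<m. row_cells B i)" by simp
  also have "\<dots> = (\<Sum>i<m. card (row_cells B i))"
    by (rule card_UN_disjoint) (use finite_B in \<open>auto simp: row_cells_def\<close>)
  finally show ?thesis using shape by (simp add: cells_shape_def)
qed

lemma card_B_cols: "card B = n * k"
proof -
  have "B = (\<Union>j<n. col_cells B j)" using col_cell(1) by (auto simp: col_cells_def)
  then have "card B = card (\<Union>j<n. col_cells B j)" by simp
  also have "\<dots> = (\<Sum>j<n. card (col_cells B j))"
    by (rule card_UN_disjoint) (use finite_B in \<open>auto simp: col_cells_def\<close>)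
  finally show ?thesis using shape by (simp add: cells_shape_def)
qed

end

context heffter
begin

text \<open>\<open>ext_bound_step\<close> is applied with \<open>z = 6\<close> and then with
  \<open>z = 0\<close>, starting from the trivial bound for up to twelve prescribed cells. Here 40
  is \<open>4 * 6 + 16\<close> and 768 is \<open>64 * 10 + 128\<close>; the second constant is
  enlarged to match the first.\<close>

lemma card_sol:
  assumes M: "dih e M" "\<exists>q\<in>P. M q \<noteq> q" and big: "40 < card B"
  shows "real (card (sol e M)) \<le> (16 * t + 768)\<^sup>2 * fact (card B) / (real (card B))\<^sup>2"
proof -
  let ?N = "real (card B)"
  let ?b = "real (16 * t + 64 * (6 + 4) + 128) * 1 / ?N"
  have S: "sol e M \<subseteq> bijs B \<Omega>" by (auto simp: sol_def)
  have "ext_bound (sol e M) (6 + 6) 1" by (rule ext_bound_trivial[OF S])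
  then have 6: "ext_bound (sol e M) 6 ?b"
    by (rule ext_bound_step[OF M]) (use big in auto)
  then have "ext_bound (sol e M) (0 + 6) ?b" by simp
  then have "ext_bound (sol e M) 0 ((16 * t + 64 * (0 + 4) + 128) * ?b / ?N)"
    by (rule ext_bound_step[OF M]) (use big in auto)
  from this[unfolded ext_bound_def, rule_format, of "{}"] have "real (card (sol e M)) \<le> (16 * t + 384) * ?b / ?N * fact (card B)" by (simp add: add.commute)
  also have "\<dots> \<le> (16 * t + 768) * ?b / ?N * fact (card B)"
    by (intro mult_right_mono divide_right_mono) auto
  also have "\<dots> = (16 * t + 768)\<^sup>2 * fact (card B) / ?N\<^sup>2" by (simp add: power2_eq_square)
  finally show ?thesis .
qed

text \<open>\<open>dih\<close> leaves \<open>M\<close> arbitrary outside \<open>P\<close>, so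
  dihedral elements can only be compared on \<open>P\<close>; this transfers \<open>good\<close>
  between functions that agree there.\<close>

lemma good_cong:
  assumes eq: "\<And>p. p \<in> P \<Longrightarrow> M p = M' p" and g: "good D e M"
  shows "good D e M'"
  unfolding good_def
proof
  fix i assume i: "i \<in> P"
  then obtain h where h: "dih e h" "h (flip i) = flip (M i)"
    "\<forall>j\<in>P. (\<exists>y\<in>J. [val D i + val D j = y] (mod int v)) \<or>
        (\<exists>p\<in>P. [val D i + val D j = val D p] (mod int v) \<and>
               [val D (M i) + val D (h j) = val D (M p)] (mod int v))"
    using g unfolding good_def by blast
  show "\<exists>h. dih e h \<and> h (flip i) = flip (M' i) \<and>
     (\<forall>j\<in>P. (\<exists>y\<in>J. [val D i + val D j = y] (mod int v)) \<or>
        (\<exists>p\<in>P. [val D i + val D j = val D p] (mod int v) \<and>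
               [val D (M' i) + val D (h j) = val D (M' p)] (mod int v)))"
  proof (intro exI[of _ h] conjI ballI)
    show "dih e h" "h (flip i) = flip (M' i)" using h eq[OF i] by simp_all
    fix j assume j: "j \<in> P"
    show "(\<exists>y\<in>J. [val D i + val D j = y] (mod int v)) \<or>
        (\<exists>p\<in>P. [val D i + val D j = val D p] (mod int v) \<and>
               [val D (M' i) + val D (h j) = val D (M' p)] (mod int v))"
      using bspec[OF h(3) j] eq i by metis
  qed
qed

definition bad :: "pf_array set" where
  "bad = {D \<in> bijs B \<Omega>. \<exists>e M. dih e M \<and> (\<exists>q\<in>P. M q \<noteq> q) \<and> good D e M}"

text \<open>By \<open>dih_unique\<close> a dihedral element is known on \<open>P\<close> from
  \<open>e\<close> and \<open>M p0\<close>. This leaves at most \<open>4 * card B\<close> cases, and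
  \<open>card_sol\<close> bounds each of them.\<close>

lemma card_bad:
  assumes big: "40 < card B"
  shows "real (card bad) \<le> 4 * (16 * t + 768)\<^sup>2 * fact (card B) / card B"
proof -
  let ?N = "real (card B)"
  have "P \<noteq> {}" using big by auto
  then obtain p0 where p0: "p0 \<in> P" by blast
  define S where "S = (\<lambda>(e, q). {D \<in> bijs B \<Omega>. \<exists>M. dih e M \<and> (\<exists>q\<in>P. M q \<noteq> q) \<and> M p0 = q \<and> good D e M})"
  let ?I = "(UNIV :: bool set) \<times> P"
  have finI: "finite ?I" using finite_P by simp
  have bad: "bad = (\<Union>x\<in>?I. S x)"
  proof
    show "bad \<subseteq> (\<Union>x\<in>?I. S x)"
    proof
      fix D assume "D \<in> bad"
      then obtain e M where "D \<in> bijs B \<Omega>" "dih e M" "\<exists>q\<in>P. M q \<noteq> q" "good D e M"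
        unfolding bad_def by blast
      then have "D \<in> S (e, M p0)" "M p0 \<in> P" using dih_rot(1)[of e M p0] p0 by (auto simp: S_def)
      then show "D \<in> (\<Union>x\<in>?I. S x)" by (intro UN_I[of "(e, M p0)"]) simp_all
    qed
    show "(\<Union>x\<in>?I. S x) \<subseteq> bad"
    proof
      fix D assume "D \<in> (\<Union>x\<in>?I. S x)"
      then obtain x where x: "D \<in> S x" by (rule UN_E)
      obtain e q where "x = (e, q)" by (cases x)
      with x have "D \<in> S (e, q)" by simp
      then show "D \<in> bad" unfolding S_def bad_def by auto
    qed
  qed
  have each: "real (card (S x)) \<le> (16 * t + 768)\<^sup>2 * fact (card B) / ?N\<^sup>2" if "x \<in> ?I" for x
  proof (cases "S x = {}")
    case True
    then show ?thesis by simp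
  next
    case False
    obtain e q where x: "x = (e, q)" by (cases x)
    from False obtain D0 where "D0 \<in> S (e, q)" using x by blast
    then obtain M where M: "dih e M" "\<exists>q\<in>P. M q \<noteq> q" "M p0 = q" by (auto simp: S_def)
    have "S x \<subseteq> sol e M"
    proof
      fix D assume "D \<in> S x"
      then obtain M' where D: "D \<in> bijs B \<Omega>" and M': "dih e M'" "M' p0 = q" "good D e M'"
        by (auto simp: S_def x)
      have "good D e M"
        by (rule good_cong[OF dih_unique[OF M'(1) M(1) p0] M'(3)]) (use M' M in auto)
      then show "D \<in> sol e M" using D by (simp add: sol_def)
    qed
    moreover have "finite (sol e M)"
      by (rule finite_subset[OF _ finite_bijs[OF finite_B card_\<Omega>]]) (auto simp: sol_def)
    ultimately have "card (S x) \<le> card (sol e M)" by (rule card_mono[rotated])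
    then show ?thesis using card_sol[OF M(1,2) big] by linarith
  qed
  have "card bad \<le> (\<Sum>x\<in>?I. card (S x))" unfolding bad by (rule card_UN_le[OF finI])
  then have "real (card bad) \<le> real (\<Sum>x\<in>?I. card (S x))" by (rule of_nat_mono)
  also have "\<dots> = (\<Sum>x\<in>?I. real (card (S x)))" by simp
  also have "\<dots> \<le> real (card ?I) * ((16 * t + 768)\<^sup>2 * fact (card B) / ?N\<^sup>2)"
    using each by (intro sum_bounded_above)
  also have "real (card ?I) = 4 * ?N" using card_P by (simp add: card_cartesian_product)
  also have "4 * ?N * ((16 * t + 768)\<^sup>2 * fact (card B) / ?N\<^sup>2) = 4 * (16 * t + 768)\<^sup>2 * fact (card B) / ?N"
    using big by (simp add: field_simps power2_eq_square)
  finally show ?thesis .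
qed

section \<open>Arrays with a vanishing row or column sum\<close>

definition zero_sum :: "cell set \<Rightarrow> pf_array set" where
  "zero_sum L = {D \<in> bijs B \<Omega>. (\<Sum>c\<in>L. the (D c)) mod int v = 0}"

text \<open>
  Exchanging the content of a fixed cell of \<open>L\<close> with that of any cell outside \<open>L\<close> destroys a
  zero sum, and both the array and the cell can be recovered from the result.
\<close>

lemma card_zero_sum:
  assumes L: "L \<subseteq> B" "L \<noteq> {}" and ne: "bijs B \<Omega> \<noteq> {}"
  shows "card (zero_sum L) * (card B - card L + 1) \<le> fact (card B)"
proof -
  obtain c where c: "c \<in> L" using L by blast
  \<comment> \<open>The choice \<open>d = c\<close> is the exchange that changes nothing; it
    accounts for the \<open>+ 1\<close>.\<close>
  let ?S = "zero_sum L" and ?T = "insert c (B - L)"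
  let ?g = "\<lambda>(D, d). D \<circ> Transposition.transpose c d"
  have cB: "c \<in> B" and TB: "?T \<subseteq> B" using c L by auto
  have finL: "finite L" using L finite_B finite_subset by metis
  have "inj_on ?g (?S \<times> ?T)"
  proof (rule inj_onI)
    fix x y assume xy: "x \<in> ?S \<times> ?T" "y \<in> ?S \<times> ?T" "?g x = ?g y"
    obtain D d where x: "x = (D, d)" by (cases x)
    obtain D' d' where y: "y = (D', d')" by (cases y)
    have D: "D \<in> ?S" "d \<in> ?T" "D' \<in> ?S" "d' \<in> ?T" using xy x y by auto
    then have bij: "D \<in> bijs B \<Omega>" "D' \<in> bijs B \<Omega>" by (auto simp: zero_sum_def)
    have eq: "D \<circ> Transposition.transpose c d = D' \<circ> Transposition.transpose c d'" using xy(3) x y by simp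
    have off: "D a = D' a" if "a \<in> L - {c}" for a
    proof -
      have "a \<noteq> c" "a \<noteq> d" "a \<noteq> d'" using that D by auto
      then have "Transposition.transpose c d a = a" "Transposition.transpose c d' a = a" by simp_all
      then show ?thesis using fun_cong[OF eq, of a] by simp
    qed
    \<comment> \<open>Off \<open>c\<close> the two arrays agree on \<open>L\<close>, so their
      vanishing sums force equal values at \<open>c\<close>.\<close>
    have "(\<Sum>a\<in>L. the (D a)) = the (D c) + (\<Sum>a\<in>L - {c}. the (D a))"
      "(\<Sum>a\<in>L. the (D' a)) = the (D' c) + (\<Sum>a\<in>L - {c}. the (D' a))"
      using finL c by (simp_all add: sum.remove)
    moreover have "(\<Sum>a\<in>L - {c}. the (D a)) = (\<Sum>a\<in>L - {c}. the (D' a))"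
      using off by (intro sum.cong) auto
    moreover have "[(\<Sum>a\<in>L. the (D a)) = (\<Sum>a\<in>L. the (D' a))] (mod int v)"
      using D by (simp add: zero_sum_def cong_def)
    ultimately have "[the (D c) = the (D' c)] (mod int v)" by (simp add: cong_add_rcancel)
    then have "[val D (c, True) = val D' (c, True)] (mod int v)" by (simp add: val_def)
    from val_determines[OF bij _ this] have Dc: "D c = D' c" using cB by simp
    let ?g0 = "D \<circ> Transposition.transpose c d"
    have "?g0 d = D c" "?g0 d' = D' c" using fun_cong[OF eq, of d'] by simp_all
    then have "?g0 d = ?g0 d'" using Dc by simp
    moreover have "?g0 \<in> bijs B \<Omega>"
      by (rule bijs_comp[OF permutes_swap_id bij(1)]) (use cB D TB in auto)
    ultimately have d: "d = d'"
      using inj_onD[OF bijs_inj_on[OF finite_B card_\<Omega>], of ?g0 d d'] D TB by blast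
    have "D = (D \<circ> Transposition.transpose c d) \<circ> Transposition.transpose c d" by (simp add: comp_assoc)
    also have "\<dots> = (D' \<circ> Transposition.transpose c d') \<circ> Transposition.transpose c d" by (simp only: eq)
    also have "\<dots> = D'" by (simp add: d comp_assoc)
    finally show "x = y" using x y d by simp
  qed
  then have "card (?S \<times> ?T) = card (?g ` (?S \<times> ?T))" by (simp add: card_image)
  also have "\<dots> \<le> card (bijs B \<Omega>)"
  proof (rule card_mono[OF finite_bijs[OF finite_B card_\<Omega>]])
    show "?g ` (?S \<times> ?T) \<subseteq> bijs B \<Omega>"
    proof (rule image_subsetI)
      fix x assume x: "x \<in> ?S \<times> ?T"
      obtain D d where Dd: "x = (D, d)" by (cases x)
      have "D \<in> bijs B \<Omega>" "d \<in> B" using x Dd TB by (auto simp: zero_sum_def)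
      then show "?g x \<in> bijs B \<Omega>" using bijs_comp[OF permutes_swap_id[OF cB]] Dd by simp
    qed
  qed
  also have "\<dots> = fact (card B)" by (rule card_bijs[OF finite_B card_\<Omega> ne])
  finally have "card ?S * card ?T \<le> fact (card B)" by (simp add: card_cartesian_product)
  moreover have "card ?T = card B - card L + 1"
    using c finite_B L finL by (simp add: card_Diff_subset)
  ultimately show ?thesis by simp
qed

text \<open>By the union bound, \<open>a\<close> lines cost at most a fraction \<open>a / w\<close>
  with \<open>w = a * b - b + 1\<close>, and \<open>7 * a \<le> 3 * w\<close> for
  \<open>a, b \<ge> 3\<close>, with equality at \<open>a = b = 3\<close>.\<close>

lemma card_zero_sum_lines:
  assumes L: "\<And>i. i < a \<Longrightarrow> L i \<subseteq> B \<and> card (L i) = b" and N: "card B = a * b" and ab: "a \<ge> 3" "b \<ge> 3"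
    and ne: "bijs B \<Omega> \<noteq> {}"
  shows "real (card (\<Union>i<a. zero_sum (L i))) \<le> 3 / 7 * fact (card B)"
proof -
  obtain x y where xy: "a = 3 + x" "b = 3 + y" using ab le_Suc_ex by metis
  have w: "card B - b + 1 = 7 + 2 * y + 3 * x + x * y" unfolding N xy by (simp add: algebra_simps)
  let ?w = "card B - b + 1"
  have aw: "7 * a \<le> 3 * ?w" by (simp only: w) (simp add: xy)
  have wpos: "real ?w > 0" by simp
  have each: "real (card (zero_sum (L i))) \<le> fact (card B) / real ?w" if "i < a" for i
  proof -
    have "L i \<noteq> {}" using L[OF that] ab by auto
    from card_zero_sum[OF _ this ne] have "card (zero_sum (L i)) * ?w \<le> fact (card B)"
      using L[OF that] by simp
    then have "real (card (zero_sum (L i)) * ?w) \<le> real (fact (card B))" by (rule of_nat_mono)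
    then have "real (card (zero_sum (L i))) * real ?w \<le> fact (card B)"
      by (simp only: of_nat_mult of_nat_fact)
    then show ?thesis using wpos by (simp only: pos_le_divide_eq)
  qed
  have "card (\<Union>i<a. zero_sum (L i)) \<le> (\<Sum>i<a. card (zero_sum (L i)))" by (rule card_UN_le) simp
  then have "real (card (\<Union>i<a. zero_sum (L i))) \<le> real (\<Sum>i<a. card (zero_sum (L i)))"
    by (rule of_nat_mono)
  also have "\<dots> = (\<Sum>i<a. real (card (zero_sum (L i))))" by simp
  also have "\<dots> \<le> real (card {..<a}) * (fact (card B) / real ?w)"
    using each by (intro sum_bounded_above) auto
  also have "\<dots> = real a / real ?w * fact (card B)" by simp
  also have "\<dots> \<le> 3 / 7 * fact (card B)"
  proof (rule mult_right_mono)
    have "7 * real a \<le> 3 * real ?w" using aw by linarith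
    then show "real a / real ?w \<le> 3 / 7" using wpos by (simp add: divide_le_eq)
  qed simp
  finally show ?thesis .
qed

definition nonzero_arrays :: "pf_array set" where
  "nonzero_arrays = {D \<in> bijs B \<Omega>. (\<forall>i<m. (\<Sum>c\<in>row_cells B i. the (D c)) mod int v \<noteq> 0) \<and>
     (\<forall>j<n. (\<Sum>c\<in>col_cells B j. the (D c)) mod int v \<noteq> 0)}"

lemma card_nonzero_arrays:
  assumes ne: "bijs B \<Omega> \<noteq> {}" and B: "B \<noteq> {}"
  shows "fact (card B) / 7 \<le> real (card nonzero_arrays)"
proof -
  obtain c where c: "c \<in> B" using B by blast
  \<comment> \<open>A column with \<open>k\<close> cells meets \<open>k\<close> different rows, so
    \<open>m \<ge> k\<close>; likewise \<open>n \<ge> h\<close>.\<close>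
  have "card (col_cells B (snd c)) \<le> card {..<m}"
    by (rule card_inj_on_le[of fst]) (use row_cell(1) in \<open>auto simp: inj_on_def col_cells_def\<close>)
  then have m: "m \<ge> 3" using col_cell(4)[OF c] k3 by simp
  have "card (row_cells B (fst c)) \<le> card {..<n}"
    by (rule card_inj_on_le[of snd]) (use col_cell(1) in \<open>auto simp: inj_on_def row_cells_def\<close>)
  then have n: "n \<ge> 3" using row_cell(4)[OF c] h3 by simp
  let ?Z1 = "\<Union>i<m. zero_sum (row_cells B i)" and ?Z2 = "\<Union>j<n. zero_sum (col_cells B j)"
  have "real (card ?Z1) \<le> 3 / 7 * fact (card B)"
    by (rule card_zero_sum_lines[OF _ card_B_rows m h3 ne])
       (use shape in \<open>auto simp: cells_shape_def row_cells_def\<close>)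
  moreover have "real (card ?Z2) \<le> 3 / 7 * fact (card B)"
    by (rule card_zero_sum_lines[OF _ card_B_cols n k3 ne])
       (use shape in \<open>auto simp: cells_shape_def col_cells_def\<close>)
  moreover have "fact (card B) \<le> real (card nonzero_arrays) + (real (card ?Z1) + real (card ?Z2))"
  proof -
    have cover: "bijs B \<Omega> \<subseteq> nonzero_arrays \<union> (?Z1 \<union> ?Z2)"
      by (auto simp: nonzero_arrays_def zero_sum_def)
    have "finite (nonzero_arrays \<union> (?Z1 \<union> ?Z2))"
      by (rule finite_subset[OF _ finite_bijs[OF finite_B card_\<Omega>]])
         (auto simp: nonzero_arrays_def zero_sum_def)
    from card_mono[OF this cover] have "card (bijs B \<Omega>) \<le> card nonzero_arrays + (card ?Z1 + card ?Z2)"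
      by (meson add_left_mono card_Un_le order_trans)
    then have "fact (card B) \<le> card nonzero_arrays + (card ?Z1 + card ?Z2)"
      by (simp add: card_bijs[OF finite_B card_\<Omega> ne])
    then have "real (fact (card B)) \<le> real (card nonzero_arrays + (card ?Z1 + card ?Z2))"
      by (rule of_nat_mono)
    then show ?thesis by (simp only: of_nat_add of_nat_fact)
  qed
  ultimately show ?thesis by linarith
qed

end

section \<open>Automorphisms of the Archdeacon embedding\<close>

lemma Jsub_diff:
  assumes "a \<in> Jsub v t" "b \<in> Jsub v t" "v > 0"
  shows "(a - b) mod int v \<in> Jsub v t"
proof -
  obtain x y where "a = int (v div t) * x mod int v" "b = int (v div t) * y mod int v"
    using assms(1,2) by (auto simp: Jsub_def)
  then have "(a - b) mod int v = int (v div t) * ((x - y) mod int v) mod int v"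
    by (simp add: mod_simps right_diff_distrib)
  moreover have "(x - y) mod int v \<in> Zmod v" using assms(3) by (simp add: Zmod_def)
  ultimately show ?thesis unfolding Jsub_def by blast
qed

context heffter
begin

section \<open>The embedding read through signed cells\<close>

lemma zero_in_Zmod: "0 \<in> Zmod v" using v_pos by (simp add: Zmod_def)

lemma mod_in_Zmod: "x mod int v \<in> Zmod v" using v_pos by (simp add: Zmod_def)

lemma Zmod_mod: "x \<in> Zmod v \<Longrightarrow> x mod int v = x" by (simp add: Zmod_def)

lemma rot_surj: "rot ` P = P"
proof (rule endo_inj_surj[OF finite_P])
  show "rot ` P \<subseteq> P"
  proof (rule image_subsetI)
    fix p assume "p \<in> P"
    then show "rot p \<in> P" by (simp add: P_iff)
  qed
  show "inj_on rot P" by (simp add: inj_on_def rot_inj)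
qed

lemma rot_in_P: "p \<in> P \<Longrightarrow> rot p \<in> P" using rot_surj by blast

lemma flip_in_P: "p \<in> P \<Longrightarrow> flip p \<in> P" by (simp add: P_iff)

lemma entry_ordering_value:
  assumes D: "D \<in> bijs B \<Omega>" and c: "c \<in> B"
  shows "entry_ordering D \<alpha> (the (D c)) = the (D (\<alpha> c))"
proof -
  have ran: "the (D c) \<in> entries D" using bijs_value(2)[OF D c] D by (simp add: bijs_def)
  have "position D (the (D c)) = c"
    unfolding position_def
  proof (rule the_equality)
    show "D c = Some (the (D c))" by (rule bijs_value(1)[OF D c])
    fix c' assume c': "D c' = Some (the (D c))"
    then have "c' \<in> B" using D by (auto simp: bijs_def)
    moreover have "D c' = D c" using c' bijs_value(1)[OF D c] by simp
    ultimately show "c' = c" using inj_onD[OF bijs_inj_on[OF finite_B card_\<Omega> D]] c by blast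
  qed
  then show ?thesis using ran by (simp add: entry_ordering_def)
qed

text \<open>The two nontrivial branches of \<open>archdeacon_rho0\<close> are the two signs, and
  \<open>\<Omega>_disjoint\<close> keeps them apart.\<close>

lemma rho0_val:
  assumes D: "D \<in> bijs B \<Omega>" and p: "p \<in> P"
  shows "archdeacon_rho0 v D (entry_ordering D \<alpha>r) (entry_ordering D \<alpha>c) (val D p) = val D (rot p)"
proof -
  have c: "fst p \<in> B" using p by auto
  have ran: "entries D = \<Omega>" using D by (simp add: bijs_def)
  note x = bijs_value(2)[OF D c]
  show ?thesis
  proof (cases "snd p")
    case True
    then show ?thesis
      using x by (simp add: val_def rot_def archdeacon_rho0_def ran entry_ordering_value[OF D c])
  next
    case False
    have "neg_mod v (neg_mod v (the (D (fst p)))) = the (D (fst p))"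
      using x X_eq by (intro neg_mod_neg_mod) blast
    then show ?thesis
      using x False \<Omega>_disjoint[OF x]
      by (simp add: val_def rot_def archdeacon_rho0_def ran entry_ordering_value[OF D c])
  qed
qed

text \<open>Oriented edges at \<open>x\<close> are labelled by signed cells through their
  difference, so that the rotation acts on the label alone
  (\<open>embedding_rotation\<close>).\<close>

definition arc :: "pf_array \<Rightarrow> int \<Rightarrow> cell \<times> bool \<Rightarrow> int \<times> int" where
  "arc D x p = (x, (x + val D p) mod int v)"

lemma val_eqI:
  assumes "D \<in> bijs B \<Omega>" "p \<in> P" "q \<in> P" "[val D p = val D q] (mod int v)"
  shows "p = q"
  using Zmod_cong_eq[OF val_in_Zmod[OF assms(1,2)] val_in_Zmod[OF assms(1,3)] assms(4)]
    val_bij[OF assms(1)] assms(2,3) by (auto simp: bij_betw_def dest: inj_onD)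

lemma arc_inj:
  assumes D: "D \<in> bijs B \<Omega>" and p: "p \<in> P" "q \<in> P" and eq: "arc D x p = arc D x q"
  shows "p = q"
proof -
  have "[x + val D p = x + val D q] (mod int v)" using eq by (simp add: arc_def cong_def)
  then have "[val D p = val D q] (mod int v)" by (simp add: cong_add_lcancel)
  then show ?thesis by (rule val_eqI[OF D p])
qed

lemma diff_mod_val:
  assumes D: "D \<in> bijs B \<Omega>" and p: "p \<in> P"
  shows "((x + val D p) mod int v - x) mod int v = val D p"
  using Zmod_mod[OF val_in_Zmod[OF D p]] by (simp add: mod_simps)

lemma arc_in_arcs:
  assumes D: "D \<in> bijs B \<Omega>" and p: "p \<in> P" and x: "x \<in> Zmod v"
  shows "arc D x p \<in> parcs (multipartite_graph v t)"
  using val_in_X[OF D p] x by (simp add: multipartite_graph_def arc_def diff_mod_val[OF D p] mod_in_Zmod)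

lemma arcs_cases:
  assumes D: "D \<in> bijs B \<Omega>" and a: "(x, y) \<in> parcs (multipartite_graph v t)"
  obtains p where "p \<in> P" "(x, y) = arc D x p" "x \<in> Zmod v"
proof -
  from a have x: "x \<in> Zmod v" and y: "y \<in> Zmod v" and "(y - x) mod int v \<in> X"
    by (auto simp: multipartite_graph_def mod_in_Zmod)
  then have "(y - x) mod int v \<in> val D ` P" using val_bij[OF D] by (simp add: bij_betw_def)
  then obtain p where p: "p \<in> P" "val D p = (y - x) mod int v" by auto
  have "(x + val D p) mod int v = y" using Zmod_mod[OF y] by (simp add: p(2) mod_simps)
  then show thesis using that[OF p(1) _ x] by (simp add: arc_def)
qed

lemma embedding_rotation:
  assumes D: "D \<in> bijs B \<Omega>" and p: "p \<in> P" and x: "x \<in> Zmod v"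
    and \<rho>: "archdeacon_embedding v t D (entry_ordering D \<alpha>r) (entry_ordering D \<alpha>c) = (G, \<rho>)"
  shows "\<rho> (arc D x p) = arc D x (rot p)"
proof -
  have "\<rho> (arc D x p) = (if arc D x p \<in> parcs (multipartite_graph v t)
      then (x, (x + archdeacon_rho0 v D (entry_ordering D \<alpha>r) (entry_ordering D \<alpha>c)
                  (((x + val D p) mod int v - x) mod int v)) mod int v) else arc D x p)"
    using \<rho> by (auto simp: archdeacon_embedding_def arc_def)
  then show ?thesis
    using arc_in_arcs[OF D p x] by (simp add: diff_mod_val[OF D p] rho0_val[OF D p] arc_def)
qed

text \<open>Needed to resolve \<open>inv \<rho>\<close> for orientation-reversing automorphisms:
  surjectivity gives \<open>\<rho> (inv \<rho> a) = a\<close>.\<close>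

lemma embedding_surj:
  assumes D: "D \<in> bijs B \<Omega>"
    and \<rho>: "archdeacon_embedding v t D (entry_ordering D \<alpha>r) (entry_ordering D \<alpha>c) = (G, \<rho>)"
  shows "surj \<rho>"
  unfolding surj_def
proof
  fix a :: "int \<times> int"
  obtain x y where a: "a = (x, y)" by (cases a)
  show "\<exists>b. a = \<rho> b"
  proof (cases "a \<in> parcs (multipartite_graph v t)")
    case True
    then obtain p where p: "p \<in> P" "a = arc D x p" "x \<in> Zmod v" using arcs_cases[OF D] a by metis
    then obtain q where q: "q \<in> P" "p = rot q" using rot_surj by (metis imageE)
    then show ?thesis using embedding_rotation[OF D q(1) p(3) \<rho>] p(2) by metis
  next
    case False
    then have "a = \<rho> a" using \<rho> a by (auto simp: archdeacon_embedding_def)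
    then show ?thesis by blast
  qed
qed

text \<open>Let \<open>M x\<close> be the action of \<open>\<sigma>\<close> on the labels of the
  edges at \<open>x\<close>. Then \<open>M 0\<close> is the witness for \<open>bad\<close>, with
  \<open>M (val D i)\<close> as the \<open>h\<close> for \<open>i\<close>; the shift
  \<open>\<sigma> 0\<close> is carried along instead of normalising \<open>\<sigma>\<close>.\<close>

lemma automorphism_bad:
  assumes D: "D \<in> bijs B \<Omega>" and B: "B \<noteq> {}"
    and \<sigma>: "\<sigma> \<in> embedding_Aut (archdeacon_embedding v t D (entry_ordering D \<alpha>r) (entry_ordering D \<alpha>c))"
    and nt: "\<sigma> \<notin> translation_set v"
  shows "D \<in> bad"
proof -
  obtain G \<rho> where \<rho>: "archdeacon_embedding v t D (entry_ordering D \<alpha>r) (entry_ordering D \<alpha>c) = (G, \<rho>)"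
    by fastforce
  then have G: "G = multipartite_graph v t" by (simp add: archdeacon_embedding_def)
  from \<sigma> have aut: "graph_automorphism G \<sigma>"
    and com: "(\<forall>a\<in>parcs G. map_prod \<sigma> \<sigma> (\<rho> a) = \<rho> (map_prod \<sigma> \<sigma> a)) \<or>
       (\<forall>a\<in>parcs G. map_prod \<sigma> \<sigma> (\<rho> a) = inv \<rho> (map_prod \<sigma> \<sigma> a))"
    unfolding embedding_Aut_def \<rho> by simp_all
  have perm: "\<sigma> permutes Zmod v" using aut by (simp add: graph_automorphism_def G multipartite_graph_def)
  have \<sigma>_in: "\<sigma> x \<in> Zmod v" if "x \<in> Zmod v" for x using permutes_in_image[OF perm] that by simp
  have \<sigma>_arc: "(\<sigma> x, \<sigma> y) \<in> parcs G" if "(x, y) \<in> parcs G" for x y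
  proof -
    have "x \<in> pverts G" "y \<in> pverts G" using that by (auto simp: G multipartite_graph_def)
    then show ?thesis using aut that unfolding graph_automorphism_def by blast
  qed

  have "\<exists>q\<in>P. (\<sigma> x, \<sigma> ((x + val D p) mod int v)) = arc D (\<sigma> x) q" if "x \<in> Zmod v" "p \<in> P" for x p
  proof -
    have "(\<sigma> x, \<sigma> ((x + val D p) mod int v)) \<in> parcs (multipartite_graph v t)"
      using \<sigma>_arc arc_in_arcs[OF D that(2,1)] by (simp add: arc_def G)
    from arcs_cases[OF D this] show ?thesis by metis
  qed
  then obtain M where M: "\<And>x p. x \<in> Zmod v \<Longrightarrow> p \<in> P \<Longrightarrow> M x p \<in> P"
    "\<And>x p. x \<in> Zmod v \<Longrightarrow> p \<in> P \<Longrightarrow> map_prod \<sigma> \<sigma> (arc D x p) = arc D (\<sigma> x) (M x p)"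
    unfolding arc_def map_prod_simp by metis
  have \<sigma>_M: "[\<sigma> ((x + val D p) mod int v) = \<sigma> x + val D (M x p)] (mod int v)"
    if "x \<in> Zmod v" "p \<in> P" for x p
    using M(2)[OF that] by (simp add: arc_def cong_def)

  have M_inj: "inj_on (M x) P" if x: "x \<in> Zmod v" for x
  proof (rule inj_onI)
    fix p q assume p: "p \<in> P" and q: "q \<in> P" and eq: "M x p = M x q"
    then have "map_prod \<sigma> \<sigma> (arc D x p) = map_prod \<sigma> \<sigma> (arc D x q)" using M(2)[OF x] by simp
    then have "\<sigma> ((x + val D p) mod int v) = \<sigma> ((x + val D q) mod int v)" by (simp add: arc_def)
    then have "(x + val D p) mod int v = (x + val D q) mod int v"
      using inj_eq[OF permutes_inj[OF perm]] by blast
    then show "p = q" using arc_inj[OF D p q, of x] by (simp add: arc_def)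
  qed

  \<comment> \<open>A single commutation rule holds at all arcs, so the type \<open>e\<close> is the
    same at every vertex.\<close>
  obtain e where e: "\<And>x. x \<in> Zmod v \<Longrightarrow> dih e (M x)"
  proof -
    have rotM: "map_prod \<sigma> \<sigma> (\<rho> (arc D x p)) = arc D (\<sigma> x) (M x (rot p))"
      "\<rho> (map_prod \<sigma> \<sigma> (arc D x p)) = arc D (\<sigma> x) (rot (M x p))"
      "arc D x p \<in> parcs G"
      if "x \<in> Zmod v" "p \<in> P" for x p
      using that M rot_in_P embedding_rotation[OF D _ _ \<rho>] \<sigma>_in arc_in_arcs[OF D] G by simp_all
    from com show thesis
    proof
      assume c: "\<forall>a\<in>parcs G. map_prod \<sigma> \<sigma> (\<rho> a) = \<rho> (map_prod \<sigma> \<sigma> a)"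
      have "M x (rot p) = rot (M x p)" if x: "x \<in> Zmod v" "p \<in> P" for x p
      proof (rule arc_inj[OF D])
        show "M x (rot p) \<in> P" "rot (M x p) \<in> P" using x M(1) rot_in_P by blast+
        show "arc D (\<sigma> x) (M x (rot p)) = arc D (\<sigma> x) (rot (M x p))"
          using bspec[OF c rotM(3)[OF x]] rotM(1,2)[OF x] by simp
      qed
      then have "dih True (M x)" if "x \<in> Zmod v" for x
        unfolding dih_def using that M(1) M_inj by simp
      then show thesis by (rule that)
    next
      assume c: "\<forall>a\<in>parcs G. map_prod \<sigma> \<sigma> (\<rho> a) = inv \<rho> (map_prod \<sigma> \<sigma> a)"
      have "rot (M x (rot p)) = M x p" if x: "x \<in> Zmod v" "p \<in> P" for x p
      proof (rule arc_inj[OF D])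
        show Mr: "rot (M x (rot p)) \<in> P" and "M x p \<in> P" using x M(1) rot_in_P by blast+
        have "arc D (\<sigma> x) (M x (rot p)) = inv \<rho> (arc D (\<sigma> x) (M x p))"
          using bspec[OF c rotM(3)[OF x]] rotM(1)[OF x] M(2)[OF x] by simp
        then have "\<rho> (arc D (\<sigma> x) (M x (rot p))) = arc D (\<sigma> x) (M x p)"
          using surj_f_inv_f[OF embedding_surj[OF D \<rho>]] by simp
        moreover have "M x (rot p) \<in> P" using x M(1) rot_in_P by blast
        ultimately show "arc D (\<sigma> x) (rot (M x (rot p))) = arc D (\<sigma> x) (M x p)"
          using embedding_rotation[OF D _ \<sigma>_in[OF x(1)] \<rho>] by simp
      qed
      then have "dih False (M x)" if "x \<in> Zmod v" for x
        unfolding dih_def using that M(1) M_inj by simp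
      then show thesis by (rule that)
    qed
  qed

  let ?g = "M 0"
  have \<sigma>_g: "[\<sigma> (val D p) = \<sigma> 0 + val D (?g p)] (mod int v)" if "p \<in> P" for p
    using \<sigma>_M[OF zero_in_Zmod that] Zmod_mod[OF val_in_Zmod[OF D that]] by simp
  have val_flip': "[val D (flip p) = - val D p] (mod int v)" if "p \<in> P" for p
    using val_flip[OF D that] neg_mod_cong by simp
  \<comment> \<open>The edge labelled \<open>flip i\<close> at the vertex \<open>val D i\<close>
    leads back to 0; the images of both ends are known and force the label of the image
    edge.\<close>
  have M_flip: "M (val D i) (flip i) = flip (?g i)" if i: "i \<in> P" for i
  proof (rule val_eqI[OF D])
    note x = val_in_Zmod[OF D i]
    show "M (val D i) (flip i) \<in> P" "flip (?g i) \<in> P"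
      using M(1) x zero_in_Zmod i flip_in_P by blast+
    have "[val D i + val D (flip i) = val D i + - val D i] (mod int v)"
      by (rule cong_add[OF cong_refl val_flip'[OF i]])
    then have "(val D i + val D (flip i)) mod int v = 0" by (simp add: cong_def)
    then have "[\<sigma> 0 = \<sigma> (val D i) + val D (M (val D i) (flip i))] (mod int v)"
      using \<sigma>_M[OF x flip_in_P[OF i]] by simp
    then have "[\<sigma> 0 = (\<sigma> 0 + val D (?g i)) + val D (M (val D i) (flip i))] (mod int v)"
      by (rule cong_trans) (rule cong_add[OF \<sigma>_g[OF i] cong_refl])
    then have "int v dvd - (val D (M (val D i) (flip i)) - - val D (?g i))"
      by (simp add: cong_iff_dvd_diff algebra_simps)
    then have "[val D (M (val D i) (flip i)) = - val D (?g i)] (mod int v)"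
      by (simp only: dvd_minus_iff cong_iff_dvd_diff)
    then show "[val D (M (val D i) (flip i)) = val D (flip (?g i))] (mod int v)"
      using val_flip'[of "?g i"] M(1)[OF zero_in_Zmod i] cong_sym cong_trans by blast
  qed

  have "good D e ?g"
    unfolding good_def
  proof
    fix i assume i: "i \<in> P"
    note x = val_in_Zmod[OF D i]
    show "\<exists>h. dih e h \<and> h (flip i) = flip (?g i) \<and>
      (\<forall>j\<in>P. (\<exists>y\<in>J. [val D i + val D j = y] (mod int v)) \<or>
        (\<exists>p\<in>P. [val D i + val D j = val D p] (mod int v) \<and>
               [val D (?g i) + val D (h j) = val D (?g p)] (mod int v)))"
    proof (intro exI[of _ "M (val D i)"] conjI ballI)
      show "dih e (M (val D i))" by (rule e[OF x])
      show "M (val D i) (flip i) = flip (?g i)" by (rule M_flip[OF i])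
      fix j assume j: "j \<in> P"
      let ?w = "(val D i + val D j) mod int v"
      have w: "[val D i + val D j = ?w] (mod int v)" by (simp add: cong_def)
      show "(\<exists>y\<in>J. [val D i + val D j = y] (mod int v)) \<or>
        (\<exists>p\<in>P. [val D i + val D j = val D p] (mod int v) \<and>
               [val D (?g i) + val D (M (val D i) j) = val D (?g p)] (mod int v))"
      proof (cases "?w \<in> J")
        case True
        then show ?thesis using w by blast
      next
        case False
        then have "?w \<in> val D ` P" using mod_in_Zmod val_bij[OF D] by (simp add: bij_betw_def)
        then obtain p where p: "p \<in> P" "?w = val D p" by blast
        \<comment> \<open>The vertex \<open>val D p\<close> is reached from 0 directly and through
          \<open>val D i\<close>; comparing both expressions for its image gives the second
          relation.\<close>
        have "[\<sigma> 0 + val D (?g p) = \<sigma> (val D i) + val D (M (val D i) j)] (mod int v)"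
          using \<sigma>_M[OF x j] \<sigma>_g[OF p(1)] unfolding p(2) using cong_sym cong_trans by blast
        also have "[\<sigma> (val D i) + val D (M (val D i) j)
            = (\<sigma> 0 + val D (?g i)) + val D (M (val D i) j)] (mod int v)"
          by (rule cong_add[OF \<sigma>_g[OF i] cong_refl])
        finally have "[\<sigma> 0 + val D (?g p) = \<sigma> 0 + (val D (?g i) + val D (M (val D i) j))] (mod int v)"
          by (simp add: add.assoc)
        then have "[val D (?g i) + val D (M (val D i) j) = val D (?g p)] (mod int v)"
          by (simp add: cong_add_lcancel cong_sym_eq)
        then show ?thesis using w p by auto
      qed
    qed
  qed
  moreover have "\<exists>q\<in>P. ?g q \<noteq> q"
  proof (rule ccontr)
    assume "\<not> ?thesis"
    then have triv: "?g q = q" if "q \<in> P" for q using that by blast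
    obtain i where i: "i \<in> P" using B by auto
    \<comment> \<open>A reflection fixing all labels would give
      \<open>rot (rot i) = i\<close>.\<close>
    have e': e
    proof (rule ccontr)
      assume "\<not> e"
      from dih_rot(3)[OF e[OF zero_in_Zmod] i this] show False
        using triv rot_in_P i rot_facts(3)[OF i] by simp
    qed
    have id: "dih e id" using e' by (simp add: dih_def)
    have \<sigma>_X: "[\<sigma> (val D p) = \<sigma> 0 + val D p] (mod int v)" if "p \<in> P" for p
      using \<sigma>_g[OF that] triv[OF that] by simp
    have "\<sigma> y = translation v (\<sigma> 0) y" for y
    proof (cases "y \<in> Zmod v")
      case False
      then show ?thesis using permutes_not_in[OF perm] by (simp add: translation_def)
    next
      case True
      have "[\<sigma> y = \<sigma> 0 + y] (mod int v)"
      proof (cases "y \<in> J")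
        case False
        then have "y \<in> val D ` P" using True val_bij[OF D] by (simp add: bij_betw_def)
        then show ?thesis using \<sigma>_X by blast
      next
        case yJ: True
        note x = val_in_Zmod[OF D i]
        \<comment> \<open>Elements of \<open>J\<close> are not adjacent to 0, but they are adjacent
          to \<open>val D i\<close>, which lies outside \<open>J\<close>.\<close>
        have "(y - val D i) mod int v \<notin> J"
        proof
          assume "(y - val D i) mod int v \<in> J"
          from Jsub_diff[OF yJ this v_pos] have "val D i \<in> J"
            using Zmod_mod[OF x] by (simp add: mod_simps)
          then show False using val_in_X[OF D i] by blast
        qed
        then have "(y - val D i) mod int v \<in> val D ` P"
          using mod_in_Zmod val_bij[OF D] by (simp add: bij_betw_def)
        then obtain j where j: "j \<in> P" "val D j = (y - val D i) mod int v" by auto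
        have y: "(val D i + val D j) mod int v = y" using Zmod_mod[OF True] by (simp add: j(2) mod_simps)
        have "M (val D i) j = id j"
          by (rule dih_unique[OF e[OF x] id flip_in_P[OF i] _ j(1)]) (simp add: M_flip[OF i] triv[OF i])
        then have "[\<sigma> y = \<sigma> (val D i) + val D j] (mod int v)" using \<sigma>_M[OF x j(1)] by (simp add: y)
        also have "[\<sigma> (val D i) + val D j = (\<sigma> 0 + val D i) + val D j] (mod int v)"
          by (rule cong_add[OF \<sigma>_X[OF i] cong_refl])
        also have "[(\<sigma> 0 + val D i) + val D j = \<sigma> 0 + y] (mod int v)"
          by (simp add: cong_def y[symmetric] mod_simps add.assoc)
        finally show ?thesis .
      qed
      then show ?thesis using True Zmod_mod[OF \<sigma>_in[OF True]] by (simp add: translation_def cong_def add.commute)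
    qed
    then have "\<sigma> = translation v (\<sigma> 0)" by blast
    then show False using nt \<sigma>_in[OF zero_in_Zmod] unfolding translation_set_def by blast
  qed
  ultimately show ?thesis using D e[OF zero_in_Zmod] unfolding bad_def by blast
qed

end

section \<open>The probability bound\<close>

lemma entries_mset_bijs:
  assumes "finite B" "card B = card W" "D \<in> bijs B W"
  shows "entries_mset D = mset_set W"
proof -
  have D: "D ` B = Some ` W" "inj_on D B" "dom D = B"
    using bijs_image[OF assms(3)] bijs_inj_on[OF assms] assms(3) by (simp_all add: bijs_def)
  have "inj_on (\<lambda>c. the (D c)) B"
  proof (rule inj_onI)
    fix c d assume c: "c \<in> B" and d: "d \<in> B" and eq: "the (D c) = the (D d)"
    have "c \<in> dom D" "d \<in> dom D" using c d D(3) by auto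
    then have "D c = D d" using eq by auto
    then show "c = d" using inj_onD[OF D(2)] c d by blast
  qed
  moreover have "(\<lambda>c. the (D c)) ` B = W"
  proof -
    have "(\<lambda>c. the (D c)) ` B = the ` (D ` B)" by (simp add: image_image)
    then show ?thesis by (simp add: D(1) image_image)
  qed
  ultimately show ?thesis by (simp add: entries_mset_def D(3) image_mset_mset_set)
qed

lemma mset_eq_mset_set: "(\<And>x. count M x \<le> 1) \<Longrightarrow> M = mset_set (set_mset M)"
proof (rule multiset_eqI)
  fix x assume "\<And>x. count M x \<le> 1"
  then have "count M x \<le> 1" .
  then show "count M x = count (mset_set (set_mset M)) x"
  proof (cases "x \<in># M")
    case True
    then have "count M x \<ge> 1" by (rule count_greater_eq_one_iff[THEN iffD2])
    then show ?thesis using True \<open>count M x \<le> 1\<close> by (simp only: count_mset_set finite_set_mset)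
  qed (simp add: not_in_iff)
qed

text \<open>The complement of the subgroup has \<open>2 * n * k\<close> elements, exactly as many as
  there are signed entries; covering each once leaves no room for repetitions or for entries in the
  subgroup.\<close>

lemma quasi_heffter_pm_mset:
  assumes qh: "quasi_heffter t m n h k D" and card: "card (skel D) = n * k" and fin: "finite (skel D)"
    and v: "v = 2 * n * k + t"
  shows "pm_mset v (entries_mset D) = mset_set (Zmod v - Jsub v t)"
    and "entries_mset D = mset_set (entries D)"
proof -
  let ?X = "Zmod v - Jsub v t" and ?M = "entries_mset D"
  have t: "t > 0" "t dvd 2 * n * k" and cov: "\<forall>x\<in>?X. count (pm_mset v ?M) x = 1"
    using qh v by (auto simp: quasi_heffter_def Let_def covers_once_def)
  have "Jsub v t \<subseteq> Zmod v" using t v by (auto simp: Jsub_def Zmod_def)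
  then have cX: "card ?X = 2 * n * k"
    using card_Jsub[OF t v] v card_Diff_subset[of "Jsub v t" "Zmod v"]
      finite_subset[of "Jsub v t" "Zmod v"]
    by (simp only: Zmod_def finite_atLeastLessThan_int card_atLeastLessThan_int)
  have sub: "mset_set ?X \<subseteq># pm_mset v ?M"
  proof (rule mset_subset_eqI)
    fix x show "count (mset_set ?X) x \<le> count (pm_mset v ?M) x"
      using cov by (cases "x \<in> ?X") (auto simp: Zmod_def)
  qed
  have "size (pm_mset v ?M) = size (mset_set ?X)"
    using card cX fin by (simp add: pm_mset_def entries_mset_def)
  with sub show pm: "pm_mset v ?M = mset_set ?X"
    using mset_subset_size[of "mset_set ?X" "pm_mset v ?M"] by (auto simp: subset_mset.le_less)
  have "count ?M x \<le> 1" for x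
  proof -
    have "count ?M x \<le> count (pm_mset v ?M) x" by (simp add: pm_mset_def)
    also have "\<dots> \<le> 1" unfolding pm by (simp add: count_mset_set')
    finally show ?thesis .
  qed
  then have "?M = mset_set (set_mset ?M)" by (rule mset_eq_mset_set)
  moreover have "set_mset ?M = entries D"
  proof -
    have "set_mset ?M = (\<lambda>c. the (D c)) ` dom D" using fin by (simp add: entries_mset_def)
    also have "\<dots> = ran D" by (force simp: ran_def dom_def image_iff)
    finally show ?thesis .
  qed
  ultimately show "?M = mset_set (entries D)" by simp
qed

theorem theorem3p14:
  fixes t :: nat
  assumes "t > 0"
  shows "\<exists>C>0. \<forall>(m::nat) (n::nat) (h::nat) (k::nat) (B :: cell set)
             (\<alpha>r :: cell \<Rightarrow> cell) (\<alpha>c :: cell \<Rightarrow> cell) (\<Omega> :: int set).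
     h \<ge> 3 \<longrightarrow> k \<ge> 3 \<longrightarrow> t dvd 2 * n * k \<longrightarrow>
     cells_shape m n h k B \<longrightarrow>
     row_ordering m B \<alpha>r \<longrightarrow> col_ordering n B \<alpha>c \<longrightarrow> compatible B \<alpha>r \<alpha>c \<longrightarrow>
     (let v = 2 * n * k + t;
          \<D> = {D. nonzero_heffter t m n h k D \<and> skel D = B \<and> entries D = \<Omega>}
      in \<Omega> \<subseteq> Zmod v \<longrightarrow> covers_once v t (mset_set \<Omega>) \<longrightarrow> \<D> \<noteq> {} \<longrightarrow>
         measure_pmf.prob (pmf_of_set \<D>)
           {D. \<exists>\<sigma> \<in> embedding_Aut
                      (archdeacon_embedding v t D (entry_ordering D \<alpha>r) (entry_ordering D \<alpha>c)).
                 \<sigma> \<notin> translation_set v}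
         \<le> C / real (n * k))"
proof -
  \<comment> \<open>\<open>K\<close> is the constant of \<open>card_bad\<close>; the 7 is the price
    of conditioning on nonzero sums, and the 40 makes the bound trivial when
    \<open>n * k \<le> 40\<close>.\<close>
  define K where "K = real (4 * (16 * t + 768)\<^sup>2)"
  define C where "C = 7 * K + 40"
  have K: "K \<ge> 0" by (simp add: K_def)
  show ?thesis
  proof (intro exI[of _ C] conjI allI impI)
    show "C > 0" using K by (simp add: C_def)
    fix m n h k :: nat and B :: "cell set" and \<alpha>r \<alpha>c :: "cell \<Rightarrow> cell" and \<Omega> :: "int set"
    assume h: "h \<ge> 3" and k: "k \<ge> 3" and tdvd: "t dvd 2 * n * k" and shape: "cells_shape m n h k B"
      and row: "row_ordering m B \<alpha>r" and col: "col_ordering n B \<alpha>c" and comp: "compatible B \<alpha>r \<alpha>c"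
    interpret orderings m n h k B \<alpha>r \<alpha>c
      by unfold_locales (fact h k shape row col comp)+
    \<comment> \<open>A cycle is nonempty, so \<open>compatible\<close> excludes an empty set of
      cells.\<close>
    have B_ne: "B \<noteq> {}" using comp by (auto simp: compatible_def cyclic_on_def)
    have N_pos: "n * k > 0" using B_ne finite_B card_B_cols by (metis card_gt_0_iff)
    define v where "v = 2 * n * k + t"
    define \<D> where "\<D> = {D. nonzero_heffter t m n h k D \<and> skel D = B \<and> entries D = \<Omega>}"
    define E where "E = {D. \<exists>\<sigma> \<in> embedding_Aut
                      (archdeacon_embedding v t D (entry_ordering D \<alpha>r) (entry_ordering D \<alpha>c)).
                 \<sigma> \<notin> translation_set v}"
    have main: "measure_pmf.prob (pmf_of_set \<D>) E \<le> C / real (n * k)"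
      if \<Omega>: "\<Omega> \<subseteq> Zmod v" "covers_once v t (mset_set \<Omega>)" and ne: "\<D> \<noteq> {}"
    proof (cases "n * k \<le> 40")
      case True
      have "measure_pmf.prob (pmf_of_set \<D>) E \<le> 1" by (rule measure_pmf.prob_le_1)
      also have "1 \<le> C / real (n * k)"
      proof -
        have "real (n * k) \<le> C" using True K unfolding C_def by linarith
        then show ?thesis using N_pos by (simp only: le_divide_eq_1_pos of_nat_0_less_iff)
      qed
      finally show ?thesis .
    next
      case False
      then have big: "40 < card B" by (simp add: card_B_cols)
      obtain D0 where D0: "nonzero_heffter t m n h k D0" "skel D0 = B" "entries D0 = \<Omega>"
        using ne by (auto simp: \<D>_def)
      then have qh: "quasi_heffter t m n h k D0" by (simp add: nonzero_heffter_def)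
      have pm: "pm_mset v (entries_mset D0) = mset_set (Zmod v - Jsub v t)"
        and em: "entries_mset D0 = mset_set \<Omega>"
        using quasi_heffter_pm_mset[OF qh _ _ v_def] D0 card_B_cols finite_B by simp_all
      have finite_\<Omega>: "finite \<Omega>" using finite_subset[OF \<Omega>(1)] by (simp add: Zmod_def)
      have "size (entries_mset D0) = card B" using D0(2) by (simp add: entries_mset_def)
      then have card_\<Omega>: "card B = card \<Omega>" by (simp add: em)
      interpret heffter m n h k B \<alpha>r \<alpha>c t v \<Omega>
        by unfold_locales (use assms tdvd v_def pm em finite_\<Omega> card_\<Omega> in simp_all)
      have \<D>: "\<D> = nonzero_arrays"
      proof
        show "\<D> \<subseteq> nonzero_arrays"
        proof
          fix D assume "D \<in> \<D>"
          then have D: "nonzero_heffter t m n h k D" and dr: "skel D = B" "entries D = \<Omega>"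
            by (auto simp: \<D>_def)
          from D have "(\<forall>i<m. (\<Sum>c\<in>row_cells (skel D) i. the (D c)) mod int v \<noteq> 0) \<and>
              (\<forall>j<n. (\<Sum>c\<in>col_cells (skel D) j. the (D c)) mod int v \<noteq> 0)"
            unfolding nonzero_heffter_def Let_def v_def by (rule conjunct2)
          then show "D \<in> nonzero_arrays" by (simp add: nonzero_arrays_def bijs_def dr)
        qed
        show "nonzero_arrays \<subseteq> \<D>"
        proof
          fix D assume D: "D \<in> nonzero_arrays"
          then have bij: "D \<in> bijs B \<Omega>" by (simp add: nonzero_arrays_def)
          then have dr: "skel D = B" "entries D = \<Omega>" by (auto simp: bijs_def)
          \<comment> \<open>Every bijection onto \<open>\<Omega>\<close> is quasi-Heffter, since its
            entries form \<open>mset_set \<Omega>\<close>; only the line sums single out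
            \<open>\<D>\<close>.\<close>
          have "quasi_heffter t m n h k D"
            using assms tdvd shape \<Omega> entries_mset_bijs[OF finite_B card_\<Omega> bij]
            by (simp add: quasi_heffter_def Let_def dr v_def)
          moreover have "(\<forall>i<m. (\<Sum>c\<in>row_cells (skel D) i. the (D c)) mod int v \<noteq> 0) \<and>
              (\<forall>j<n. (\<Sum>c\<in>col_cells (skel D) j. the (D c)) mod int v \<noteq> 0)"
            using D by (simp add: nonzero_arrays_def dr)
          ultimately have "nonzero_heffter t m n h k D"
            unfolding nonzero_heffter_def Let_def v_def by (rule conjI)
          then show "D \<in> \<D>" using dr by (simp add: \<D>_def)
        qed
      qed
      have bne: "bijs B \<Omega> \<noteq> {}" using D0 by (auto simp: bijs_def)
      have fin: "finite \<D>" unfolding \<D>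
        by (rule finite_subset[OF _ finite_bijs[OF finite_B card_\<Omega>]]) (auto simp: nonzero_arrays_def)
      have finbad: "finite bad"
        by (rule finite_subset[OF _ finite_bijs[OF finite_B card_\<Omega>]]) (auto simp: bad_def)
      have sub: "\<D> \<inter> E \<subseteq> bad"
      proof
        fix D assume "D \<in> \<D> \<inter> E"
        then show "D \<in> bad"
          using automorphism_bad[OF _ B_ne] by (auto simp: \<D> E_def nonzero_arrays_def)
      qed
      have "real (card (\<D> \<inter> E)) \<le> real (card bad)"
        by (rule of_nat_mono[OF card_mono[OF finbad sub]])
      also have "\<dots> \<le> K * fact (card B) / card B"
        using card_bad[OF big] by (simp add: K_def)
      finally have num: "real (card (\<D> \<inter> E)) \<le> K * fact (card B) / card B" .
      have den: "fact (card B) / 7 \<le> real (card \<D>)"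
        unfolding \<D> by (rule card_nonzero_arrays[OF bne B_ne])
      have "measure_pmf.prob (pmf_of_set \<D>) E = real (card (\<D> \<inter> E)) / real (card \<D>)"
        by (rule measure_pmf_of_set[OF ne fin])
      also have "\<dots> \<le> (K * fact (card B) / card B) / (fact (card B) / 7)"
        by (rule frac_le[OF _ num _ den]) (use K in auto)
      also have "\<dots> = 7 * K / real (n * k)" by (simp add: card_B_cols)
      also have "\<dots> \<le> C / real (n * k)" by (intro divide_right_mono) (auto simp: C_def)
      finally show ?thesis .
    qed
    show "let v = 2 * n * k + t;
          \<D> = {D. nonzero_heffter t m n h k D \<and> skel D = B \<and> entries D = \<Omega>}
      in \<Omega> \<subseteq> Zmod v \<longrightarrow> covers_once v t (mset_set \<Omega>) \<longrightarrow> \<D> \<noteq> {} \<longrightarrow>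
         measure_pmf.prob (pmf_of_set \<D>)
           {D. \<exists>\<sigma> \<in> embedding_Aut
                      (archdeacon_embedding v t D (entry_ordering D \<alpha>r) (entry_ordering D \<alpha>c)).
                 \<sigma> \<notin> translation_set v}
         \<le> C / real (n * k)"
      using main unfolding Let_def v_def \<D>_def E_def by blast
  qed
qed

end
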